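(* There exist absolute constants $K,K'>0$ such that the following holds. Let $n\ge1$, $\epsilon\ge0$, $\delta>0$ with $\delta\ge K\sqrt{\epsilon}$, and let $f\colon S_n\to\mathbb{R}$ be linear with $\Pr[f\notin\{0,1\}]\le\epsilon$ and $\delta\le\Pr[f=1]\le1-\delta$. Then there is a dictator $g$ with $\Pr[f\neq g]\le K'\epsilon/\delta$.
   Context: $S_n$ is the symmetric group on $[n]$; probabilities are over uniformly random $\pi\in S_n$. $x_{i,j}(\pi)=1$ if $\pi(i)=j$ and $0$ otherwise; $f$ is linear if $f=\sum_{i,j}c_{i,j}x_{i,j}$ for reals $c_{i,j}$. A dictator is a function of the form $\sum_{(i,j)\in\mathcal{C}}x_{i,j}$ where all elements of $\mathcal{C}\subseteq[n]^2$ share the same first coordinate or all share the same second coordinate. *)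

theory Defs
  imports "HOL-Probability.Probability" "HOL-Combinatorics.Permutations"
begin

text \<open>The symmetric group on \<open>[n] = {1..n}\<close>. Functions on it are total functions on
  \<^typ>\<open>nat \<Rightarrow> nat\<close>, of which only the values on \<open>Sym n\<close> are relevant.\<close>

definition Sym :: "nat \<Rightarrow> (nat \<Rightarrow> nat) set" where
  "Sym n = {\<pi>. \<pi> permutes {1..n}}"

definition Sym_prob :: "nat \<Rightarrow> ((nat \<Rightarrow> nat) \<Rightarrow> bool) \<Rightarrow> real" where
  "Sym_prob n P = measure_pmf.prob (pmf_of_set (Sym n)) {\<pi>. P \<pi>}"

definition perm_entry :: "nat \<Rightarrow> nat \<Rightarrow> (nat \<Rightarrow> nat) \<Rightarrow> real" where
  "perm_entry i j \<pi> = (if \<pi> i = j then 1 else 0)"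

definition linear_on_Sym :: "nat \<Rightarrow> ((nat \<Rightarrow> nat) \<Rightarrow> real) \<Rightarrow> bool" where
  "linear_on_Sym n f \<longleftrightarrow>
     (\<exists>c :: nat \<Rightarrow> nat \<Rightarrow> real. \<forall>\<pi>\<in>Sym n. f \<pi> = (\<Sum>i\<in>{1..n}. \<Sum>j\<in>{1..n}. c i j * perm_entry i j \<pi>))"

text \<open>The set \<open>C\<close> may be empty, so the zero function is a dictator.\<close>

definition dictator :: "nat \<Rightarrow> ((nat \<Rightarrow> nat) \<Rightarrow> real) \<Rightarrow> bool" where
  "dictator n g \<longleftrightarrow>
     (\<exists>C \<subseteq> {1..n} \<times> {1..n}.
        ((\<exists>i. \<forall>p\<in>C. fst p = i) \<or> (\<exists>j. \<forall>p\<in>C. snd p = j)) \<and>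
        (\<forall>\<pi>\<in>Sym n. g \<pi> = (\<Sum>(i, j)\<in>C. perm_entry i j \<pi>)))"

end

theory Submission
  imports Defs
begin

text \<open>Write \<open>f \<pi> = (\<Sum>i. c i (\<pi> i))\<close>. Swapping the values \<open>j, j'\<close> at \<open>i, i'\<close> changes \<open>f\<close> by a second
  difference of \<open>c\<close> that depends only on the quadruple \<open>(i, i', j, j')\<close>; call the quadruple sensitive if it
  is nonzero. If \<open>\<pi>\<close> contains two disjoint sensitive quadruples, performing the two swaps independently
  gives four permutations, at one of which \<open>f\<close> is not Boolean. Hence in a random matching of rows and
  columns two sensitive quadruples occur with probability at most \<open>4 * \<epsilon>\<close>.

  The number of sensitive quadruples controls the distance of \<open>f\<close> from constants, so there are at least
  \<open>\<delta> * n ^ 3\<close> of them. If \<open>\<epsilon>\<close> is below a multiple of \<open>1 / n\<^sup>2\<close>, no two sensitive quadruples are disjoint, and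
  then all of them share a row or a column, so \<open>f\<close> depends on one row or column only. For larger \<open>\<epsilon>\<close> a
  moment computation shows that some row or column lies in a constant fraction of them (otherwise two
  occur with probability of order \<open>\<delta>\<^sup>2\<close>, against \<open>\<delta> \<ge> K * sqrt \<epsilon>\<close>), and that only \<open>O(\<epsilon> / \<delta>) * n ^ 3\<close> of
  them avoid this line. Applying the control on the distance to the remaining lines, \<open>f\<close> is a
  function of that line up to an error \<open>O(\<epsilon> / \<delta>)\<close>.\<close>

section \<open>Swaps and sensitive quadruples\<close>

definition lin :: "nat \<Rightarrow> (nat \<Rightarrow> nat \<Rightarrow> real) \<Rightarrow> (nat \<Rightarrow> nat) \<Rightarrow> real" where
  "lin n c \<pi> = (\<Sum>i\<in>{1..n}. c i (\<pi> i))"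

definition sensitive :: "(nat \<Rightarrow> nat \<Rightarrow> real) \<Rightarrow> nat \<Rightarrow> nat \<Rightarrow> nat \<Rightarrow> nat \<Rightarrow> bool" where
  "sensitive c i i' j j' \<longleftrightarrow> c i j + c i' j' \<noteq> c i j' + c i' j"

definition bad :: "nat \<Rightarrow> (nat \<Rightarrow> nat \<Rightarrow> real) \<Rightarrow> (nat \<Rightarrow> nat) set" where
  "bad n c = {\<pi> \<in> Sym n. lin n c \<pi> \<notin> {0, 1}}"

lemma finite_Sym [simp]: "finite (Sym n)"
  by (simp add: Sym_def finite_permutations)

lemma card_Sym: "card (Sym n) = fact n"
  by (simp add: Sym_def card_permutations)

lemma Sym_nonempty: "Sym n \<noteq> {}"
  by (metis Sym_def empty_iff mem_Collect_eq permutes_id)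

lemma Sym_prob_eq: "Sym_prob n P = real (card {\<pi> \<in> Sym n. P \<pi>}) / fact n"
  by (simp add: Sym_prob_def measure_pmf_of_set Sym_nonempty card_Sym Int_def)

lemma Sym_in: "\<pi> \<in> Sym n \<Longrightarrow> i \<in> {1..n} \<Longrightarrow> \<pi> i \<in> {1..n}"
  by (simp add: Sym_def permutes_in_image del: atLeastAtMost_iff)

lemma Sym_inj: "\<pi> \<in> Sym n \<Longrightarrow> \<pi> i = \<pi> j \<longleftrightarrow> i = j"
  by (auto simp: Sym_def dest: permutes_inj injD)

lemma Sym_swap:
  assumes "\<pi> \<in> Sym n" "a \<in> {1..n}" "b \<in> {1..n}"
  shows "\<pi> \<circ> Transposition.transpose a b \<in> Sym n"
  using assms by (auto simp: Sym_def intro!: permutes_compose permutes_swap_id)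

lemma lin_swap:
  assumes "\<pi> \<in> Sym n" "a \<in> {1..n}" "b \<in> {1..n}" "a \<noteq> b"
  shows "lin n c (\<pi> \<circ> Transposition.transpose a b)
       = lin n c \<pi> - (c a (\<pi> a) + c b (\<pi> b) - c a (\<pi> b) - c b (\<pi> a))"
proof -
  have split: "(\<Sum>i\<in>{1..n}. g i) = g a + g b + (\<Sum>i\<in>{1..n} - {a, b}. g i)" for g :: "nat \<Rightarrow> real"
  proof -
    have "{a, b} \<subseteq> {1..n}" using assms by auto
    then have "(\<Sum>i\<in>{1..n}. g i) = (\<Sum>i\<in>{1..n} - {a, b}. g i) + (\<Sum>i\<in>{a, b}. g i)"
      by (intro sum.subset_diff) auto
    then show ?thesis using assms by simp
  qed
  have "(\<Sum>i\<in>{1..n} - {a, b}. c i ((\<pi> \<circ> Transposition.transpose a b) i)) = (\<Sum>i\<in>{1..n} - {a, b}. c i (\<pi> i))"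
    by (rule sum.cong) (auto simp: transpose_def)
  then show ?thesis
    using split[of "\<lambda>i. c i ((\<pi> \<circ> Transposition.transpose a b) i)"] split[of "\<lambda>i. c i (\<pi> i)"] assms
    by (simp add: lin_def)
qed

text \<open>Block k consists of the rows 2k+1 and 2k+2. Distinct blocks are disjoint, so swaps in
  different blocks do not interact, and one permutation can be tested for several sensitive
  quadruples at once.\<close>

definition active :: "(nat \<Rightarrow> nat \<Rightarrow> real) \<Rightarrow> (nat \<Rightarrow> nat) \<Rightarrow> nat \<Rightarrow> bool" where
  "active c \<pi> k \<longleftrightarrow> sensitive c (2*k+1) (2*k+2) (\<pi> (2*k+1)) (\<pi> (2*k+2))"

definition flip :: "nat \<Rightarrow> (nat \<Rightarrow> nat) \<Rightarrow> (nat \<Rightarrow> nat)" where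
  "flip k \<pi> = \<pi> \<circ> Transposition.transpose (2*k+1) (2*k+2)"

lemma flip_flip [simp]: "flip k (flip k \<pi>) = \<pi>"
  by (simp add: flip_def fun_eq_iff)

text \<open>A swap inside block k only negates its second difference, and the other blocks are left
  alone. Any choice made from the set of active blocks alone is therefore unchanged by
  flips.\<close>

lemma active_flip [simp]: "active c (flip k \<pi>) l \<longleftrightarrow> active c \<pi> l"
proof (cases "k = l")
  case True
  then show ?thesis by (auto simp: active_def flip_def sensitive_def)
next
  case False
  then have "2*l+1 \<noteq> 2*k+1" "2*l+2 \<noteq> 2*k+2" "2*l+1 \<noteq> 2*k+2" "2*l+2 \<noteq> 2*k+1" by presburger+
  then show ?thesis by (simp add: active_def flip_def transpose_def)
qed

text \<open>Flipping the first two active pairs gives four permutations; an affine function of two bits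
  that depends on both of them takes a value outside \<open>{0, 1}\<close>.\<close>

lemma card_two_active_le:
  assumes "2 * T \<le> n"
  shows "card {\<pi> \<in> Sym n. \<exists>k<T. \<exists>l<T. k \<noteq> l \<and> active c \<pi> k \<and> active c \<pi> l} \<le> 4 * card (bad n c)"
proof -
  define B where "B = {\<pi> \<in> Sym n. \<exists>k<T. \<exists>l<T. k \<noteq> l \<and> active c \<pi> k \<and> active c \<pi> l}"
  \<comment> \<open>\<open>LEAST\<close> makes the two chosen blocks functions of the set of active
    blocks, hence invariant under flips; this is why the maps \<open>\<phi>1\<close> and
    \<open>\<phi>2\<close> below are involutions.\<close>
  define k1 where "k1 \<pi> = (LEAST k. active c \<pi> k)" for \<pi>
  define k2 where "k2 \<pi> = (LEAST l. active c \<pi> l \<and> l \<noteq> k1 \<pi>)" for \<pi>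
  have k1_flip: "k1 (flip k \<pi>) = k1 \<pi>" and k2_flip: "k2 (flip k \<pi>) = k2 \<pi>" for k \<pi>
    by (simp_all add: k1_def k2_def)
  have ks: "active c \<pi> (k1 \<pi>)" "k1 \<pi> < T" "active c \<pi> (k2 \<pi>)" "k2 \<pi> \<noteq> k1 \<pi>" "k2 \<pi> < T" if "\<pi> \<in> B" for \<pi>
  proof -
    from that obtain k l where kl: "k < T" "l < T" "k \<noteq> l" "active c \<pi> k" "active c \<pi> l"
      by (auto simp: B_def)
    show "active c \<pi> (k1 \<pi>)" unfolding k1_def using kl(4) by (rule LeastI)
    have "k1 \<pi> \<le> k" unfolding k1_def using kl(4) by (rule Least_le)
    then show "k1 \<pi> < T" using kl by simp
    define m where "m = (if k = k1 \<pi> then l else k)"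
    have m: "active c \<pi> m \<and> m \<noteq> k1 \<pi>" "m < T" using kl by (auto simp: m_def)
    have "active c \<pi> (k2 \<pi>) \<and> k2 \<pi> \<noteq> k1 \<pi>" unfolding k2_def using m(1) by (rule LeastI)
    then show "active c \<pi> (k2 \<pi>)" "k2 \<pi> \<noteq> k1 \<pi>" by auto
    have "k2 \<pi> \<le> m" unfolding k2_def using m(1) by (rule Least_le)
    then show "k2 \<pi> < T" using m by simp
  qed
  have flip_B: "flip k \<pi> \<in> B" if "\<pi> \<in> B" "k < T" for k \<pi>
  proof -
    have "flip k \<pi> \<in> Sym n"
      unfolding flip_def using that assms by (intro Sym_swap) (auto simp: B_def)
    then show ?thesis using that by (auto simp: B_def)
  qed
  define \<phi>1 where "\<phi>1 \<pi> = flip (k1 \<pi>) \<pi>" for \<pi>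
  define \<phi>2 where "\<phi>2 \<pi> = flip (k2 \<pi>) \<pi>" for \<pi>
  have inj1: "inj_on \<phi>1 X" for X
    by (rule inj_on_inverseI[where g = \<phi>1]) (simp add: \<phi>1_def k1_flip)
  have inj2: "inj_on \<phi>2 X" for X
    by (rule inj_on_inverseI[where g = \<phi>2]) (simp add: \<phi>2_def k2_flip)
  have inj12: "inj_on (\<lambda>\<pi>. \<phi>2 (\<phi>1 \<pi>)) X" for X
    using comp_inj_on[OF inj1 inj2] by (simp add: comp_def)
  have bad4: "\<pi> \<in> bad n c \<or> \<phi>1 \<pi> \<in> bad n c \<or> \<phi>2 \<pi> \<in> bad n c \<or> \<phi>2 (\<phi>1 \<pi>) \<in> bad n c" if "\<pi> \<in> B" for \<pi>
  proof -
    note k = ks[OF that]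
    have S: "\<rho> \<in> Sym n" if "\<rho> \<in> B" for \<rho> using that by (simp add: B_def)
    define a where "a = 2 * k1 \<pi> + 1"
    define b where "b = 2 * k1 \<pi> + 2"
    define d where "d = 2 * k2 \<pi> + 1"
    define e where "e = 2 * k2 \<pi> + 2"
    have r: "a \<in> {1..n}" "b \<in> {1..n}" "a \<noteq> b" "d \<in> {1..n}" "e \<in> {1..n}" "d \<noteq> e"
      using k assms by (auto simp: a_def b_def d_def e_def)
    have ne: "a \<noteq> d" "a \<noteq> e" "b \<noteq> d" "b \<noteq> e"
      using k(4) unfolding a_def b_def d_def e_def by presburger+
    have B1: "\<phi>1 \<pi> \<in> B" and B2: "\<phi>2 \<pi> \<in> B" and B3: "\<phi>2 (\<phi>1 \<pi>) \<in> B"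
      using flip_B k that by (auto simp: \<phi>1_def \<phi>2_def k2_flip)
    have "\<phi>2 (\<phi>1 \<pi>) = flip (k2 \<pi>) (\<phi>1 \<pi>)"
      by (simp only: \<phi>1_def \<phi>2_def k2_flip)
    then have e1: "\<phi>1 \<pi> = \<pi> \<circ> Transposition.transpose a b" and e2: "\<phi>2 \<pi> = \<pi> \<circ> Transposition.transpose d e"
      and e3: "\<phi>2 (\<phi>1 \<pi>) = \<phi>1 \<pi> \<circ> Transposition.transpose d e"
      by (simp_all add: \<phi>1_def \<phi>2_def k2_flip flip_def a_def b_def d_def e_def)
    have v: "\<phi>1 \<pi> d = \<pi> d" "\<phi>1 \<pi> e = \<pi> e"
      using ne by (auto simp: e1 transpose_def)
    define x where "x = lin n c \<pi>"
    define D1 where "D1 = c a (\<pi> a) + c b (\<pi> b) - c a (\<pi> b) - c b (\<pi> a)"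
    define D2 where "D2 = c d (\<pi> d) + c e (\<pi> e) - c d (\<pi> e) - c e (\<pi> d)"
    have D: "D1 \<noteq> 0" "D2 \<noteq> 0"
      using k by (auto simp: D1_def D2_def active_def sensitive_def a_def b_def d_def e_def)
    have l1: "lin n c (\<phi>1 \<pi>) = x - D1"
      unfolding e1 x_def D1_def using S[OF that] r by (intro lin_swap) auto
    have l2: "lin n c (\<phi>2 \<pi>) = x - D2"
      unfolding e2 x_def D2_def using S[OF that] r by (intro lin_swap) auto
    have l3: "lin n c (\<phi>2 (\<phi>1 \<pi>)) = x - D1 - D2"
      unfolding e3 using lin_swap[OF S[OF B1] r(4,5,6), of c] by (simp add: l1 v D2_def)
    \<comment> \<open>The four values are x, x - D1, x - D2 and x - D1 - D2. If the first three are
      Boolean, then D1 = D2 is -1 (for x = 0) or 1 (for x = 1), and the fourth value is 2 or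
      -1.\<close>
    show ?thesis
      using S[OF that] S[OF B1] S[OF B2] S[OF B3] D l1 l2 l3
      by (auto simp: bad_def x_def)
  qed
  have fin: "finite B" by (simp add: B_def)
  have finb: "finite (bad n c)" by (simp add: bad_def)
  \<comment> \<open>Each of the four maps is injective, so its preimage of \<open>bad n c\<close> in
    \<open>B\<close> is no larger than \<open>bad n c\<close>; this gives the factor 4.\<close>
  define P where "P \<phi> = {\<pi> \<in> B. \<phi> \<pi> \<in> bad n c}" for \<phi> :: "(nat \<Rightarrow> nat) \<Rightarrow> (nat \<Rightarrow> nat)"
  have cP: "card (P \<phi>) \<le> card (bad n c)" if "\<And>X. inj_on \<phi> X" for \<phi>
    by (rule card_inj_on_le[of \<phi>]) (use that finb in \<open>auto simp: P_def\<close>)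
  have "B \<subseteq> P id \<union> P \<phi>1 \<union> P \<phi>2 \<union> P (\<lambda>\<pi>. \<phi>2 (\<phi>1 \<pi>))"
    using bad4 by (auto simp: P_def)
  then have "card B \<le> card (P id \<union> P \<phi>1 \<union> P \<phi>2 \<union> P (\<lambda>\<pi>. \<phi>2 (\<phi>1 \<pi>)))"
    by (rule card_mono[rotated]) (simp add: P_def fin)
  also have "\<dots> \<le> card (P id) + card (P \<phi>1) + card (P \<phi>2) + card (P (\<lambda>\<pi>. \<phi>2 (\<phi>1 \<pi>)))"
    by (meson add_mono card_Un_le le_refl le_trans)
  also have "\<dots> \<le> 4 * card (bad n c)"
    using cP[of id] cP[OF inj1] cP[OF inj2] cP[OF inj12] by simp
  finally show ?thesis by (simp add: B_def)
qed

section \<open>Counting permutations with prescribed values\<close>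

text \<open>The values are corrected one point at a time by a transposition applied after
  \<open>\<sigma>\<close>. It moves at most \<open>\<sigma> x\<close> and \<open>y\<close>, neither
  of which is a value already prescribed.\<close>

lemma ex_Sym_map:
  assumes "length xs = length ys" "distinct xs" "distinct ys" "set xs \<subseteq> {1..n}" "set ys \<subseteq> {1..n}"
  shows "\<exists>\<sigma>\<in>Sym n. map \<sigma> xs = ys"
  using assms
proof (induction xs ys rule: list_induct2)
  case Nil
  then show ?case using Sym_nonempty by auto
next
  case (Cons x xs y ys)
  then obtain \<sigma> where \<sigma>: "\<sigma> \<in> Sym n" "map \<sigma> xs = ys" by auto
  define \<tau> where "\<tau> = Transposition.transpose (\<sigma> x) y \<circ> \<sigma>"
  have "\<sigma> x \<in> {1..n}" "y \<in> {1..n}" using Cons.prems Sym_in[OF \<sigma>(1), of x] by auto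
  then have "\<tau> \<in> Sym n"
    using \<sigma>(1) unfolding Sym_def \<tau>_def by (auto intro!: permutes_compose permutes_swap_id)
  moreover have "\<tau> u = \<sigma> u" if "u \<in> set xs" for u
  proof -
    have "\<sigma> u \<noteq> \<sigma> x" using Sym_inj[OF \<sigma>(1)] that Cons.prems by auto
    moreover have "\<sigma> u \<noteq> y" using that \<sigma>(2) Cons.prems by auto
    ultimately show ?thesis by (simp add: \<tau>_def transpose_def)
  qed
  ultimately show ?case using \<sigma>(2) by (intro bexI[of _ \<tau>]) (auto simp: \<tau>_def)
qed

text \<open>The permutations in question form a coset: \<open>\<sigma>0\<close> composed with the
  permutations of the points outside \<open>xs\<close>.\<close>

lemma card_Sym_map_eq:
  assumes "length xs = length ys" "distinct xs" "distinct ys" "set xs \<subseteq> {1..n}" "set ys \<subseteq> {1..n}"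
  shows "card {\<sigma> \<in> Sym n. map \<sigma> xs = ys} = fact (n - length xs)"
proof -
  obtain \<sigma>0 where \<sigma>0: "\<sigma>0 \<in> Sym n" "map \<sigma>0 xs = ys" using ex_Sym_map[OF assms] by auto
  have p0: "\<sigma>0 permutes {1..n}" using \<sigma>0 by (simp add: Sym_def)
  let ?A = "{\<rho>. \<rho> permutes ({1..n} - set xs)}"
  have "bij_betw (\<lambda>\<rho>. \<sigma>0 \<circ> \<rho>) ?A {\<sigma> \<in> Sym n. map \<sigma> xs = ys}"
  proof (rule bij_betw_byWitness[where f' = "\<lambda>\<sigma>. inv \<sigma>0 \<circ> \<sigma>"])
    show "\<forall>\<rho>\<in>?A. inv \<sigma>0 \<circ> (\<sigma>0 \<circ> \<rho>) = \<rho>"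
      using permutes_inv_o(2)[OF p0] by (simp add: o_assoc)
    show "\<forall>\<sigma>\<in>{\<sigma> \<in> Sym n. map \<sigma> xs = ys}. \<sigma>0 \<circ> (inv \<sigma>0 \<circ> \<sigma>) = \<sigma>"
      using permutes_inv_o(1)[OF p0] by (simp add: o_assoc)
    show "(\<lambda>\<rho>. \<sigma>0 \<circ> \<rho>) ` ?A \<subseteq> {\<sigma> \<in> Sym n. map \<sigma> xs = ys}"
    proof safe
      fix \<rho> assume \<rho>: "\<rho> permutes ({1..n} - set xs)"
      then have "\<rho> permutes {1..n}" by (rule permutes_subset) auto
      then show "\<sigma>0 \<circ> \<rho> \<in> Sym n" using p0 by (simp add: Sym_def permutes_compose)
      have "\<rho> u = u" if "u \<in> set xs" for u using permutes_not_in[OF \<rho>] that by simp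
      then show "map (\<sigma>0 \<circ> \<rho>) xs = ys" using \<sigma>0(2) by auto
    qed
    show "(\<lambda>\<sigma>. inv \<sigma>0 \<circ> \<sigma>) ` {\<sigma> \<in> Sym n. map \<sigma> xs = ys} \<subseteq> ?A"
    proof safe
      fix \<sigma> assume \<sigma>: "\<sigma> \<in> Sym n" "ys = map \<sigma> xs"
      have "\<sigma> u = \<sigma>0 u" if "u \<in> set xs" for u
        using \<sigma>0(2) \<sigma>(2) that by (metis map_eq_conv)
      then have fix_xs: "(inv \<sigma>0 \<circ> \<sigma>) u = u" if "u \<in> set xs" for u
        using that permutes_inverses(2)[OF p0] by simp
      have "inv \<sigma>0 \<circ> \<sigma> permutes {1..n}"
        using \<sigma>(1) p0 by (simp add: Sym_def permutes_compose permutes_inv)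
      then show "inv \<sigma>0 \<circ> \<sigma> permutes ({1..n} - set xs)"
        by (rule permutes_superset) (use fix_xs in auto)
    qed
  qed
  then have "card {\<sigma> \<in> Sym n. map \<sigma> xs = ys} = card ?A"
    by (simp add: bij_betw_same_card)
  also have "\<dots> = fact (n - length xs)"
    using assms by (simp add: card_permutations card_Diff_subset distinct_card)
  finally show ?thesis .
qed

definition dlists :: "nat \<Rightarrow> nat \<Rightarrow> nat list set" where
  "dlists n m = {us. length us = m \<and> distinct us \<and> set us \<subseteq> {1..n}}"

lemma finite_dlists [simp]: "finite (dlists n m)"
  by (rule finite_subset[OF _ finite_lists_length_eq[of "{1..n}" m]]) (auto simp: dlists_def)

lemma map_Sym_dlists:
  assumes "\<sigma> \<in> Sym n" "xs \<in> dlists n m"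
  shows "map \<sigma> xs \<in> dlists n m"
proof -
  have "inj_on \<sigma> (set xs)" using Sym_inj[OF assms(1)] by (auto simp: inj_on_def)
  moreover have "\<sigma> u \<in> {1..n}" if "u \<in> set xs" for u
    using that assms(2) Sym_in[OF assms(1), of u] by (auto simp: dlists_def)
  ultimately show ?thesis using assms(2) by (auto simp: dlists_def distinct_map)
qed

text \<open>The image of a fixed tuple under a uniform permutation is uniform on
  \<open>dlists n m\<close>, each tuple arising from (n - m)! permutations.\<close>

lemma card_Sym_map:
  assumes "xs \<in> dlists n m"
  shows "card {\<sigma> \<in> Sym n. P (map \<sigma> xs)} = card {us \<in> dlists n m. P us} * fact (n - m)"
proof -
  have "{\<sigma> \<in> Sym n. P (map \<sigma> xs)} = (\<Union>us\<in>{us \<in> dlists n m. P us}. {\<sigma> \<in> Sym n. map \<sigma> xs = us})"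
    using map_Sym_dlists[OF _ assms] by auto
  then have "card {\<sigma> \<in> Sym n. P (map \<sigma> xs)}
      = (\<Sum>us\<in>{us \<in> dlists n m. P us}. card {\<sigma> \<in> Sym n. map \<sigma> xs = us})"
    by (simp only:) (rule card_UN_disjoint, auto)
  also have "\<dots> = (\<Sum>us\<in>{us \<in> dlists n m. P us}. fact (n - m))"
    using assms by (intro sum.cong refl) (auto simp: dlists_def card_Sym_map_eq)
  finally show ?thesis by simp
qed

text \<open>The analogue for two independent permutations; events about a random matching of rows
  and columns are counted in this way.\<close>

lemma card_Sym_map2:
  assumes "xs \<in> dlists n m"
  shows "card {(\<sigma>, \<pi>) \<in> Sym n \<times> Sym n. P (map \<sigma> xs) (map \<pi> xs)}
       = card {(us, vs) \<in> dlists n m \<times> dlists n m. P us vs} * (fact (n - m))\<^sup>2"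
proof -
  have "card {(\<sigma>, \<pi>) \<in> Sym n \<times> Sym n. P (map \<sigma> xs) (map \<pi> xs)}
      = card (SIGMA \<sigma>:Sym n. {\<pi> \<in> Sym n. P (map \<sigma> xs) (map \<pi> xs)})"
    by (rule arg_cong[where f = card]) auto
  also have "\<dots> = (\<Sum>\<sigma>\<in>Sym n. card {vs \<in> dlists n m. P (map \<sigma> xs) vs} * fact (n - m))"
    by (subst card_SigmaI) (simp_all add: card_Sym_map[OF assms])
  also have "\<dots> = (\<Sum>\<sigma>\<in>Sym n. \<Sum>vs\<in>dlists n m. if P (map \<sigma> xs) vs then fact (n - m) else 0)"
    by (simp add: sum.If_cases Int_def)
  also have "\<dots> = (\<Sum>vs\<in>dlists n m. \<Sum>\<sigma>\<in>Sym n. if P (map \<sigma> xs) vs then fact (n - m) else 0)"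
    by (rule sum.swap)
  also have "\<dots> = (\<Sum>vs\<in>dlists n m. card {\<sigma> \<in> Sym n. P (map \<sigma> xs) vs} * fact (n - m))"
    by (simp add: sum.If_cases Int_def)
  also have "\<dots> = (\<Sum>vs\<in>dlists n m. card {us \<in> dlists n m. P us vs}) * (fact (n - m))\<^sup>2"
    by (simp add: card_Sym_map[OF assms, of "\<lambda>us. P us v" for v] sum_distrib_right power2_eq_square mult.assoc)
  also have "(\<Sum>vs\<in>dlists n m. card {us \<in> dlists n m. P us vs})
      = card (SIGMA vs:dlists n m. {us \<in> dlists n m. P us vs})"
    by simp
  also have "\<dots> = card {(us, vs) \<in> dlists n m \<times> dlists n m. P us vs}"
    by (rule bij_betw_same_card[of "\<lambda>(v, u). (u, v)"])
       (auto intro!: bij_betw_byWitness[where f' = "\<lambda>(u, v). (v, u)"])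
  finally show ?thesis .
qed

section \<open>Relabelling the rows\<close>

lemma inv_Sym: "\<pi> \<in> Sym n \<Longrightarrow> inv \<pi> \<in> Sym n"
  by (simp add: Sym_def permutes_inv)

lemma lin_relabel:
  assumes "\<sigma> \<in> Sym n" "\<pi> \<in> Sym n"
  shows "lin n (\<lambda>i. c (\<sigma> i)) \<pi> = lin n c (\<pi> \<circ> inv \<sigma>)"
proof -
  have p: "\<sigma> permutes {1..n}" using assms by (simp add: Sym_def)
  show ?thesis
    unfolding lin_def
    by (subst sum.permute[OF p, of "\<lambda>i. c i ((\<pi> \<circ> inv \<sigma>) i)"]) (simp add: permutes_inverses[OF p])
qed

text \<open>Relabelling the rows amounts to precomposing with \<open>inv \<sigma>\<close>, which is
  injective. Bounds for the fixed blocks thus carry over to arbitrary rows.\<close>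

lemma card_bad_relabel:
  assumes "\<sigma> \<in> Sym n"
  shows "card (bad n (\<lambda>i. c (\<sigma> i))) \<le> card (bad n c)"
proof (rule card_inj_on_le[of "\<lambda>\<pi>. \<pi> \<circ> inv \<sigma>"])
  have p: "\<sigma> permutes {1..n}" using assms by (simp add: Sym_def)
  show "inj_on (\<lambda>\<pi>. \<pi> \<circ> inv \<sigma>) (bad n (\<lambda>i. c (\<sigma> i)))"
    by (rule inj_on_inverseI[where g = "\<lambda>\<pi>. \<pi> \<circ> \<sigma>"])
       (simp add: o_assoc[symmetric] permutes_inv_o[OF p])
  show "(\<lambda>\<pi>. \<pi> \<circ> inv \<sigma>) ` bad n (\<lambda>i. c (\<sigma> i)) \<subseteq> bad n c"
    using inv_Sym[OF assms] assms
    by (auto simp: bad_def lin_relabel) (auto simp: Sym_def intro: permutes_compose)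
qed (simp add: bad_def)

lemma sensitive_swap_rows: "sensitive c i' i j j' = sensitive c i i' j j'"
  and sensitive_swap_cols: "sensitive c i i' j' j = sensitive c i i' j j'"
  by (auto simp: sensitive_def)

lemma sensitive_distinct: "sensitive c i i' j j' \<Longrightarrow> i \<noteq> i' \<and> j \<noteq> j'"
  by (auto simp: sensitive_def)

text \<open>After relabelling a, b, a', b' as rows 1 to 4, both conditions say that blocks 0 and 1
  are active, so \<open>card_two_active_le\<close> applies. Each choice of four columns accounts for
  (n - 4)! permutations.\<close>

lemma card_two_rows_le:
  assumes "[a, b, a', b'] \<in> dlists n 4"
  shows "card {vs \<in> dlists n 4. sensitive c a b (vs!0) (vs!1) \<and> sensitive c a' b' (vs!2) (vs!3)} * fact (n - 4)
       \<le> 4 * card (bad n c)"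
proof -
  have n: "4 \<le> n"
    using assms card_mono[of "{1..n}" "set [a, b, a', b']"] distinct_card[of "[a, b, a', b']"]
    by (simp add: dlists_def)
  then have x: "[1, 2, 3, 4] \<in> dlists n 4" by (auto simp: dlists_def)
  obtain \<sigma> where \<sigma>: "\<sigma> \<in> Sym n" "map \<sigma> [1, 2, 3, 4] = [a, b, a', b']"
    using ex_Sym_map[of "[1, 2, 3, 4]" "[a, b, a', b']" n] assms x by (auto simp: dlists_def)
  define c' where "c' = (\<lambda>i. c (\<sigma> i))"
  have "card {vs \<in> dlists n 4. sensitive c a b (vs!0) (vs!1) \<and> sensitive c a' b' (vs!2) (vs!3)} * fact (n - 4)
      = card {\<pi> \<in> Sym n. sensitive c a b (\<pi> 1) (\<pi> 2) \<and> sensitive c a' b' (\<pi> 3) (\<pi> 4)}"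
    using card_Sym_map[OF x, of "\<lambda>vs. sensitive c a b (vs!0) (vs!1) \<and> sensitive c a' b' (vs!2) (vs!3)"]
    by (simp add: numeral_eq_Suc)
  also have "\<dots> \<le> card {\<pi> \<in> Sym n. \<exists>k<2. \<exists>l<2. k \<noteq> l \<and> active c' \<pi> k \<and> active c' \<pi> l}"
  proof (rule card_mono)
    show "{\<pi> \<in> Sym n. sensitive c a b (\<pi> 1) (\<pi> 2) \<and> sensitive c a' b' (\<pi> 3) (\<pi> 4)}
       \<subseteq> {\<pi> \<in> Sym n. \<exists>k<2. \<exists>l<2. k \<noteq> l \<and> active c' \<pi> k \<and> active c' \<pi> l}"
    proof safe
      fix \<pi> :: "nat \<Rightarrow> nat" assume "sensitive c a b (\<pi> 1) (\<pi> 2)" "sensitive c a' b' (\<pi> 3) (\<pi> 4)"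
      then have "active c' \<pi> 0" "active c' \<pi> 1"
        using \<sigma>(2) by (auto simp: active_def c'_def sensitive_def numeral_eq_Suc)
      then show "\<exists>k<2. \<exists>l<2. k \<noteq> l \<and> active c' \<pi> k \<and> active c' \<pi> l"
        by (intro exI[of _ 0] conjI exI[of _ 1]) auto
    qed
  qed simp
  also have "\<dots> \<le> 4 * card (bad n c')"
    using n by (intro card_two_active_le) auto
  also have "\<dots> \<le> 4 * card (bad n c)"
    using card_bad_relabel[OF \<sigma>(1), of c] by (simp add: c'_def)
  finally show ?thesis .
qed

section \<open>Functions with few sensitive quadruples\<close>

lemma card_Sym_at:
  assumes "r \<in> {1..n}"
  shows "card {\<pi> \<in> Sym n. P (\<pi> r)} = card {j \<in> {1..n}. P j} * fact (n - 1)"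
proof -
  have "[r] \<in> dlists n 1" using assms by (simp add: dlists_def)
  from card_Sym_map[OF this, of "\<lambda>us. P (hd us)"]
  have "card {\<pi> \<in> Sym n. P (\<pi> r)} = card {us \<in> dlists n 1. P (hd us)} * fact (n - 1)"
    by simp
  also have "{us \<in> dlists n 1. P (hd us)} = (\<lambda>j. [j]) ` {j \<in> {1..n}. P j}"
    by (auto simp: dlists_def length_Suc_conv)
  also have "card \<dots> = card {j \<in> {1..n}. P j}"
    by (rule card_image) (simp add: inj_on_def)
  finally show ?thesis .
qed

text \<open>The quadruples are ordered (two rows, then two columns); degenerate ones drop out by
  \<open>sensitive_distinct\<close>. Only the rows are confined to \<open>R\<close>: columns are
  removed by passing to the transposed array.\<close>

definition sensitive_quads :: "nat \<Rightarrow> (nat \<Rightarrow> nat \<Rightarrow> real) \<Rightarrow> nat set \<Rightarrow> (nat \<times> nat \<times> nat \<times> nat) set" where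
  "sensitive_quads n c R = {(r, l, j, j'). r \<in> R \<and> l \<in> R \<and> j \<in> {1..n} \<and> j' \<in> {1..n} \<and> sensitive c r l j j'}"

lemma sensitive_quads_subset: "sensitive_quads n c R \<subseteq> R \<times> R \<times> {1..n} \<times> {1..n}"
  by (auto simp: sensitive_quads_def)

lemma finite_sensitive_quads [simp]: "finite R \<Longrightarrow> finite (sensitive_quads n c R)"
  by (rule finite_subset[OF sensitive_quads_subset]) auto

text \<open>Subtracting a row \<open>l\<close> that minimises the total number of sensitive quadruples, and then the
  most frequent entry of each row in \<open>R\<close>, leaves few nonzero entries in the rows \<open>R\<close>.\<close>

lemma close_to_rows_outside:
  assumes "R \<subseteq> {1..n}" "R \<noteq> {}"
  obtains \<alpha> :: "nat \<Rightarrow> nat \<Rightarrow> real" and c0 :: real where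
    "card {\<pi> \<in> Sym n. lin n c \<pi> \<noteq> c0 + (\<Sum>i\<in>{1..n} - R. \<alpha> i (\<pi> i))} * (n\<^sup>2 * card R)
      \<le> card (sensitive_quads n c R) * fact n"
proof -
  have finR: "finite R" using assms(1) finite_subset by blast
  have n: "{1..n} \<noteq> {}" using assms by auto
  \<comment> \<open>This counts the columns in which row r minus row l takes a value other than its
    value in column j.\<close>
  define h where "h r l j = card {j' \<in> {1..n}. sensitive c r l j j'}" for r l j
  define g where "g l = (\<Sum>r\<in>R. \<Sum>j\<in>{1..n}. h r l j)" for l
  have cq: "card (sensitive_quads n c R) = (\<Sum>l\<in>R. g l)"
  proof -
    have "card (sensitive_quads n c R) = card (SIGMA l:R. SIGMA r:R. SIGMA j:{1..n}. {j' \<in> {1..n}. sensitive c r l j j'})"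
      by (rule bij_betw_same_card[of "\<lambda>(r, l, j, j'). (l, r, j, j')"],
          rule bij_betw_byWitness[where f' = "\<lambda>(l, r, j, j'). (r, l, j, j')"])
         (auto simp: sensitive_quads_def)
    also have "\<dots> = (\<Sum>l\<in>R. g l)"
      using finR by (simp add: card_SigmaI g_def h_def finite_SigmaI)
    finally show ?thesis .
  qed
  \<comment> \<open>The best row is at least as good as the average one, which gains the factor
    \<open>card R\<close>.\<close>
  obtain l where l: "l \<in> R" "\<And>r. r \<in> R \<Longrightarrow> g l \<le> g r"
    using ex_min_if_finite[of "g ` R"] finR assms(2)
    by (metis (mono_tags, lifting) arg_min_if_finite(1) arg_min_least)
  have gl: "g l * card R \<le> card (sensitive_quads n c R)"
    unfolding cq using sum_bounded_below[of R "g l" g] l(2) by (simp add: mult.commute)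
  \<comment> \<open>The column \<open>J r\<close> carries the most frequent value of row r minus row
    l. Its count of misses is at most the average over the columns, which gains a factor n.\<close>
  have "\<exists>j\<in>{1..n}. \<forall>j'\<in>{1..n}. h r l j \<le> h r l j'" for r
    using n by (metis (mono_tags, lifting) arg_min_if_finite(1) arg_min_least finite_atLeastAtMost)
  then obtain J where J: "\<And>r. J r \<in> {1..n}" "\<And>r j'. j' \<in> {1..n} \<Longrightarrow> h r l (J r) \<le> h r l j'"
    by metis
  define s where "s r = h r l (J r)" for r
  have ns: "n * s r \<le> (\<Sum>j\<in>{1..n}. h r l j)" for r
    using sum_bounded_below[of "{1..n}" "s r" "h r l"] J(2) by (simp add: s_def)
  define \<alpha> where "\<alpha> i j = c i j - c l j" for i j
  \<comment> \<open>Row l summed along a permutation always gives the sum of all its entries, so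
    subtracting it from every row changes the function by a constant only.\<close>
  define c0 where "c0 = (\<Sum>j\<in>{1..n}. c l j) + (\<Sum>r\<in>R. c r (J r) - c l (J r))"
  define F where "F = {\<pi> \<in> Sym n. lin n c \<pi> \<noteq> c0 + (\<Sum>i\<in>{1..n} - R. \<alpha> i (\<pi> i))}"
  \<comment> \<open>An error forces some row r of \<open>R\<close> to miss its most frequent
    difference, which happens for \<open>s r\<close> of the n values of
    \<open>\<pi> r\<close>.\<close>
  have "F \<subseteq> (\<Union>r\<in>R. {\<pi> \<in> Sym n. sensitive c r l (J r) (\<pi> r)})"
  proof
    fix \<pi> assume \<pi>: "\<pi> \<in> F"
    show "\<pi> \<in> (\<Union>r\<in>R. {\<pi> \<in> Sym n. sensitive c r l (J r) (\<pi> r)})"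
    proof (rule ccontr)
      assume "\<pi> \<notin> (\<Union>r\<in>R. {\<pi> \<in> Sym n. sensitive c r l (J r) (\<pi> r)})"
      then have e: "c r (\<pi> r) = c l (\<pi> r) + (c r (J r) - c l (J r))" if "r \<in> R" for r
        using \<pi> that by (auto simp: F_def sensitive_def)
      have p: "\<pi> permutes {1..n}" using \<pi> by (simp add: F_def Sym_def)
      have spl: "(\<Sum>i\<in>{1..n}. w i) = (\<Sum>i\<in>{1..n} - R. w i) + (\<Sum>i\<in>R. w i)" for w :: "nat \<Rightarrow> real"
        using assms(1) by (intro sum.subset_diff) auto
      have "(\<Sum>j\<in>{1..n}. c l j) = (\<Sum>i\<in>{1..n}. c l (\<pi> i))"
        using sum.permute[OF p, of "c l"] by (simp add: comp_def)
      also have "\<dots> = (\<Sum>i\<in>{1..n} - R. c l (\<pi> i)) + (\<Sum>i\<in>R. c l (\<pi> i))" by (rule spl)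
      finally have "lin n c \<pi> = c0 + (\<Sum>i\<in>{1..n} - R. \<alpha> i (\<pi> i))"
        using e unfolding lin_def spl[of "\<lambda>i. c i (\<pi> i)"] c0_def \<alpha>_def
        by (simp add: sum.distrib sum_subtractf)
      then show False using \<pi> by (simp add: F_def)
    qed
  qed
  then have "card F \<le> card (\<Union>r\<in>R. {\<pi> \<in> Sym n. sensitive c r l (J r) (\<pi> r)})"
    by (rule card_mono[rotated]) (simp add: finR)
  also have "\<dots> \<le> (\<Sum>r\<in>R. card {\<pi> \<in> Sym n. sensitive c r l (J r) (\<pi> r)})"
    by (rule card_UN_le[OF finR])
  also have "\<dots> = (\<Sum>r\<in>R. s r * fact (n - 1))"
    using assms(1) by (intro sum.cong refl) (subst card_Sym_at, auto simp: s_def h_def)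
  finally have F: "card F \<le> (\<Sum>r\<in>R. s r) * fact (n - 1)" by (simp add: sum_distrib_right)
  have "n * (\<Sum>r\<in>R. s r) \<le> g l"
    unfolding g_def sum_distrib_left by (rule sum_mono) (rule ns)
  have fn: "fact n = n * (fact (n - 1) :: nat)"
    using n fact_reduce[of n, where 'a = nat] by force
  have "card F * (n\<^sup>2 * card R) \<le> ((\<Sum>r\<in>R. s r) * fact (n - 1)) * (n\<^sup>2 * card R)"
    using F by (rule mult_right_mono) simp
  also have "\<dots> = (n * (\<Sum>r\<in>R. s r)) * card R * fact n"
    unfolding fn by (simp add: power2_eq_square)
  also have "\<dots> \<le> g l * card R * fact n"
    using \<open>n * (\<Sum>r\<in>R. s r) \<le> g l\<close> by (intro mult_right_mono) auto
  also have "\<dots> \<le> card (sensitive_quads n c R) * fact n"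
    using gl by (rule mult_right_mono) simp
  finally show ?thesis using that unfolding F_def by blast
qed

section \<open>Arrays without two disjoint sensitive quadruples\<close>

lemma ex_outside_three:
  assumes "finite S" "4 \<le> card S"
  shows "\<exists>m\<in>S. m \<noteq> a \<and> m \<noteq> b \<and> m \<noteq> e"
proof (rule ccontr)
  assume "\<not> ?thesis"
  then have "S \<subseteq> {a, b, e}" by auto
  then have "card S \<le> card {a, b, e}" by (rule card_mono[rotated]) simp
  then show False using assms(2) card_length[of "[a, b, e]"] by simp
qed

text \<open>Here d and d' stand for the differences of two disjoint pairs of rows. The pairs of
  columns separated by d form a complete multipartite graph, and likewise for d'. If every edge of
  one graph meets every edge of the other, both are stars with a common centre x.\<close>

lemma cross_disjoint_const_off:
  fixes d d' :: "'a \<Rightarrow> 'b"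
  assumes S: "finite S" "4 \<le> card S"
    and disj: "\<And>j j' m m'. {j, j', m, m'} \<subseteq> S \<Longrightarrow> distinct [j, j', m, m'] \<Longrightarrow> d j = d j' \<or> d' m = d' m'"
    and nc: "\<exists>u\<in>S. \<exists>v\<in>S. d u \<noteq> d v" and nc': "\<exists>u\<in>S. \<exists>v\<in>S. d' u \<noteq> d' v"
  shows "\<exists>x\<in>S. \<forall>u\<in>S - {x}. \<forall>v\<in>S - {x}. d u = d v \<and> d' u = d' v"
proof -
  note out = ex_outside_three[OF S]
  obtain y1 y2 where y: "y1 \<in> S" "y2 \<in> S" "d y1 \<noteq> d y2" using nc by auto
  have c1: "d' u = d' v" if "u \<in> S - {y1, y2}" "v \<in> S - {y1, y2}" for u v
    using disj[of y1 y2 u v] y that by (cases "u = v") auto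
  obtain m0 where m0: "m0 \<in> S" "m0 \<noteq> y1" "m0 \<noteq> y2" using out[of y1 y2 y2] by auto
  \<comment> \<open>Since d' is constant away from y1 and y2 but not constant, it deviates at one of
    these two; that one is the centre x.\<close>
  have "d' y1 \<noteq> d' m0 \<or> d' y2 \<noteq> d' m0"
  proof (rule ccontr)
    assume "\<not> ?thesis"
    then have "d' u = d' m0" if "u \<in> S" for u
      using c1[of u m0] that m0 by (cases "u = y1 \<or> u = y2") auto
    then show False using nc' by metis
  qed
  then obtain x y where xy: "x \<in> S" "y \<in> S" "{x, y} = {y1, y2}" "d' x \<noteq> d' m0" "d x \<noteq> d y"
    using y by (metis insert_commute)
  have c2: "d' x \<noteq> d' m" if "m \<in> S - {x, y}" for m
    using c1[of m m0] that xy m0 by auto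
  \<comment> \<open>As d' separates x from m, d cannot separate u from y.\<close>
  have dy: "d u = d y" if u: "u \<in> S - {x}" for u
  proof -
    obtain m where m: "m \<in> S" "m \<noteq> x" "m \<noteq> y" "m \<noteq> u" using out[of x y u] by auto
    then show ?thesis using disj[of u y x m] c2[of m] xy u by (cases "u = y") auto
  qed
  \<comment> \<open>With the roles exchanged: d separates x from m, so d' cannot separate u from
    v.\<close>
  have "d' u = d' v" if uv: "u \<in> S - {x}" "v \<in> S - {x}" for u v
  proof -
    obtain m where m: "m \<in> S" "m \<noteq> x" "m \<noteq> u" "m \<noteq> v" using out[of x u v] by auto
    have "d x \<noteq> d m" using dy[of m] m xy(5) by auto
    then show ?thesis using disj[of x m u v] m xy(1) uv by (cases "u = v") auto
  qed
  moreover have "d u = d v" if "u \<in> S - {x}" "v \<in> S - {x}" for u v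
    using dy[OF that(1)] dy[OF that(2)] by simp
  ultimately show ?thesis using xy(1) by blast
qed

text \<open>Two rows are equivalent (\<open>E\<close>) if their difference \<open>d\<close> is
  constant over the columns, and equivalent off x (\<open>F x\<close>) if it is constant over the
  columns other than x; both relations are transitive. Either all rows but one are equivalent, or
  there are two disjoint pairs of inequivalent rows. In the second case
  \<open>cross_disjoint_const_off\<close> gives these pairs a common exceptional column j, which
  then serves every other row too.\<close>

lemma common_line:
  assumes n: "4 \<le> n"
    and disj: "\<And>i i' p p' j j' q q'. [i, i', p, p'] \<in> dlists n 4 \<Longrightarrow> [j, j', q, q'] \<in> dlists n 4 \<Longrightarrow>
       \<not> (sensitive c i i' j j' \<and> sensitive c p p' q q')"
  shows "(\<exists>i\<in>{1..n}. sensitive_quads n c ({1..n} - {i}) = {}) \<or>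
         (\<exists>j\<in>{1..n}. sensitive_quads n (\<lambda>a b. c b a) ({1..n} - {j}) = {})"
proof -
  define S where "S = {1..n}"
  have S: "finite S" "4 \<le> card S" using n by (auto simp: S_def)
  note out = ex_outside_three[OF S]
  define d where "d r s j = c r j - c s j" for r s j
  have sens_d: "sensitive c r s j j' \<longleftrightarrow> d r s j \<noteq> d r s j'" for r s j j' by (auto simp: sensitive_def d_def)
  define E where "E r s \<longleftrightarrow> (\<forall>j\<in>S. \<forall>j'\<in>S. d r s j = d r s j')" for r s
  define F where "F x r s \<longleftrightarrow> (\<forall>j\<in>S - {x}. \<forall>j'\<in>S - {x}. d r s j = d r s j')" for x r s
  have F_D: "d r s u = d r s v" if "F x r s" "u \<in> S - {x}" "v \<in> S - {x}" for x r s u v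
    using that unfolding F_def by blast
  have F_sym: "F x r s \<Longrightarrow> F x s r" for x r s by (force simp: F_def d_def)
  have E_sym: "E r s \<Longrightarrow> E s r" for r s by (force simp: E_def d_def)
  have add: "d r t j = d r s j + d s t j" for r s t j by (simp add: d_def)
  have F_trans: "F x r t" if "F x r s" "F x s t" for x r s t
    using that unfolding F_def add[of r t _ s] by metis
  have E_trans: "E r t" if "E r s" "E s t" for r s t
    using that unfolding E_def add[of r t _ s] by metis
  have E_F: "E r s \<Longrightarrow> F x r s" for x r s by (auto simp: E_def F_def)
  have refl: "E r r" for r by (simp add: E_def d_def)
  have M: "\<exists>x\<in>S. F x p q \<and> F x s t"
    if "{p, q, s, t} \<subseteq> S" "distinct [p, q, s, t]" "\<not> E p q" "\<not> E s t" for p q s t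
  proof -
    have "\<exists>x\<in>S. \<forall>u\<in>S - {x}. \<forall>v\<in>S - {x}. d p q u = d p q v \<and> d s t u = d s t v"
    proof (rule cross_disjoint_const_off[OF S])
      show "d p q j = d p q j' \<or> d s t m = d s t m'"
        if "{j, j', m, m'} \<subseteq> S" "distinct [j, j', m, m']" for j j' m m'
        using disj[of p q s t j j' m m'] that \<open>{p, q, s, t} \<subseteq> S\<close> \<open>distinct [p, q, s, t]\<close>
        by (auto simp: sens_d dlists_def S_def)
    qed (use that in \<open>auto simp: E_def\<close>)
    then show ?thesis unfolding F_def by blast
  qed
  \<comment> \<open>With two exceptional columns x and y, a third column m agrees with x because
    only y is excepted, and with all others because only x is; then the difference is
    constant.\<close>
  have uniq: "x = y" if "F x p q" "F y p q" "\<not> E p q" for x y p q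
  proof (rule ccontr)
    assume xy: "x \<noteq> y"
    obtain m where m: "m \<in> S" "m \<noteq> x" "m \<noteq> y" using out[of x y y] by auto
    have "d p q u = d p q m" if "u \<in> S" for u
      using F_D[OF \<open>F x p q\<close>, of u m] F_D[OF \<open>F y p q\<close>, of u m] that m xy by (cases "u = x") blast+
    then show False using \<open>\<not> E p q\<close> unfolding E_def by metis
  qed
  show ?thesis
  proof (cases "\<exists>i\<in>S. \<forall>r\<in>S - {i}. \<forall>l\<in>S - {i}. E r l")
    case True
    then obtain i where i: "i \<in> S" "\<And>r l. r \<in> S - {i} \<Longrightarrow> l \<in> S - {i} \<Longrightarrow> E r l" by blast
    then have "sensitive_quads n c (S - {i}) = {}"
      unfolding sensitive_quads_def sens_d E_def S_def by blast
    then show ?thesis using i(1) unfolding S_def by blast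
  next
    case False
    then have no: "\<exists>r\<in>S - {i}. \<exists>l\<in>S - {i}. \<not> E r l" if "i \<in> S" for i using that by auto
    have "1 \<in> S" using n by (auto simp: S_def)
    then obtain p0 q0 where pq0: "p0 \<in> S" "q0 \<in> S" "\<not> E p0 q0" using no by blast
    have "\<exists>p q s t. {p, q, s, t} \<subseteq> S \<and> distinct [p, q, s, t] \<and> \<not> E p q \<and> \<not> E s t"
    proof (cases "\<exists>r\<in>S - {p0, q0}. \<exists>s\<in>S - {p0, q0}. \<not> E r s")
      case True
      then obtain r s where "r \<in> S - {p0, q0}" "s \<in> S - {p0, q0}" "\<not> E r s" by auto
      then show ?thesis using pq0 refl by (intro exI[of _ p0] exI[of _ q0] exI[of _ r] exI[of _ s]) auto
    next
      case False
      then have oth: "E r s" if "r \<in> S - {p0, q0}" "s \<in> S - {p0, q0}" for r s using that by blast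
      obtain r where r: "r \<in> S" "r \<noteq> p0" "r \<noteq> q0" using out[of p0 q0 q0] by auto
      obtain s where s: "s \<in> S" "s \<noteq> p0" "s \<noteq> q0" "s \<noteq> r" using out[of p0 q0 r] by auto
      \<comment> \<open>If b were equivalent to the other rows, all rows except a would be
        equivalent. So neither p0 nor q0 is equivalent to them, and pairing p0 with r and q0 with s
        gives two disjoint inequivalent pairs.\<close>
      have key: "\<not> E b r" if ab: "{a, b} = {p0, q0}" "a \<noteq> b" for a b
      proof
        assume br: "E b r"
        have "E u r" if "u \<in> S - {a}" for u
          using that br oth[of u r] r ab by (cases "u = b") auto
        then have "\<forall>u\<in>S - {a}. \<forall>v\<in>S - {a}. E u v" using E_sym E_trans by blast
        moreover have "a \<in> S" using ab pq0 by auto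
        ultimately show False using no[of a] by blast
      qed
      have ne: "p0 \<noteq> q0" using pq0 refl by auto
      have "\<not> E p0 r" "\<not> E q0 r" using key[of q0 p0] key[of p0 q0] ne by auto
      moreover have "E s r" using oth[of s r] r s by auto
      ultimately have "\<not> E p0 r" "\<not> E q0 s" using E_trans by blast+
      then show ?thesis using pq0 r s ne
        by (intro exI[of _ p0] exI[of _ r] exI[of _ q0] exI[of _ s]) auto
    qed
    then obtain p q s t where pqst: "{p, q, s, t} \<subseteq> S" "distinct [p, q, s, t]" "\<not> E p q" "\<not> E s t"
      by blast
    obtain j where j: "j \<in> S" "F j p q" "F j s t" using M[OF pqst] by auto
    \<comment> \<open>This links the two pairs. If no cross pair is equivalent, the pairings p-s,
      q-t and p-t, q-s have exceptional columns x and y. Were both different from j, going from p to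
      q through s would make the difference constant at j as well, and p and q would be
      equivalent.\<close>
    have ps: "F j p s"
    proof (cases "E p s \<or> E p t \<or> E q s \<or> E q t")
      case True
      then show ?thesis using j E_F[of _ _ j] F_sym[of j] F_trans[of j] by metis
    next
      case False
      obtain x where x: "F x p s" "F x q t" using M[of p s q t] pqst False by auto
      obtain y where y: "F y p t" "F y q s" using M[of p t q s] pqst False by auto
      have "x = j \<or> y = j"
      proof (rule ccontr)
        assume xy: "\<not> ?thesis"
        obtain m where m: "m \<in> S" "m \<noteq> x" "m \<noteq> y" "m \<noteq> j" using out[of x y j] by auto
        have "d p s j = d p s m" "d s q j = d s q m"
          using F_D[OF x(1), of j m] F_D[OF F_sym[OF y(2)], of j m] xy m j(1) by blast+
        then have "d p q j = d p q m" unfolding add[of p q _ s] by simp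
        then have "d p q u = d p q m" if "u \<in> S" for u
          using that F_D[OF j(2), of u m] m by (cases "u = j") auto
        then show False using pqst(3) unfolding E_def by metis
      qed
      then show ?thesis
      proof
        assume "x = j" then show ?thesis using x by simp
      next
        assume "y = j" then show ?thesis using y j F_trans[OF _ F_sym] by blast
      qed
    qed
    \<comment> \<open>A row u outside the four is inequivalent to p or to q. Comparing that pair
      with s, t yields an exceptional column, which is j by \<open>uniq\<close>.\<close>
    have all: "F j u p" if u: "u \<in> S" for u
    proof (cases "u \<in> {p, q, s, t}")
      case True
      then show ?thesis using j ps refl E_F F_sym F_trans by blast
    next
      case False
      have "\<not> E u p \<or> \<not> E u q" using pqst(3) E_sym E_trans by blast
      then show ?thesis
      proof
        assume up: "\<not> E u p"
        then obtain x where "F x u p" "F x s t" using M[of u p s t] pqst u False by auto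
        then show ?thesis using uniq[of x s t j] j pqst(4) by auto
      next
        assume uq: "\<not> E u q"
        then obtain x where "F x u q" "F x s t" using M[of u q s t] pqst u False by auto
        then have "F j u q" using uniq[of x s t j] j pqst(4) by auto
        then show ?thesis using F_trans F_sym[OF j(2)] by blast
      qed
    qed
    have "F j u v" if "u \<in> S" "v \<in> S" for u v using all that F_sym F_trans by blast
    then have "\<not> sensitive (\<lambda>a b. c b a) m m' u v"
      if "m \<in> S - {j}" "m' \<in> S - {j}" "u \<in> S" "v \<in> S" for m m' u v
      using F_D[of j u v m m'] that by (auto simp: sensitive_def d_def)
    then have "sensitive_quads n (\<lambda>a b. c b a) (S - {j}) = {}"
      unfolding sensitive_quads_def S_def[symmetric] by blast
    then show ?thesis using j(1) unfolding S_def by blast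
  qed
qed

text \<open>Two triples of bits with equal sums agree up to order; the six disjuncts are the six
  ways of matching them.\<close>

lemma balanced_bits:
  fixes a b c d e g :: real
  assumes "a \<in> {0, 1}" "b \<in> {0, 1}" "c \<in> {0, 1}" "d \<in> {0, 1}" "e \<in> {0, 1}" "g \<in> {0, 1}"
    and "a + b + c = d + e + g"
  shows "a = g \<and> d = c \<and> b = e \<or> d = b \<and> a = e \<and> g = c \<or> c = e \<and> g = b \<and> a = d \<or>
    a = g \<and> d = b \<and> c = e \<or> d = c \<and> a = e \<and> g = b \<or> b = e \<and> g = c \<and> a = d"
  using assms by (elim insertE emptyE; simp)

text \<open>Three rows contain no two disjoint pairs, so this case needs another argument. The
  values at the three even permutations use every entry of the array once, as do those at the three
  odd ones, so the sums agree. The six matchings of \<open>balanced_bits\<close> say precisely that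
  one of the three pairs of rows or of the three pairs of columns differs by a constant.\<close>

lemma common_line_3:
  assumes b: "bad 3 c = {}"
  shows "(\<exists>i\<in>{1..3}. sensitive_quads 3 c ({1..3} - {i}) = {}) \<or>
         (\<exists>j\<in>{1..3}. sensitive_quads 3 (\<lambda>a b. c b a) ({1..3} - {j}) = {})"
proof -
  have set3: "{1..3::nat} = {1, 2, 3}" by auto
  have v: "c 1 x + c 2 y + c 3 z \<in> {0, 1}" if xyz: "distinct [x, y, z]" "{x, y, z} \<subseteq> {1..3}" for x y z
  proof -
    obtain \<sigma> where "\<sigma> \<in> Sym 3" "map \<sigma> [1, 2, 3] = [x, y, z]"
      using ex_Sym_map[of "[1, 2, 3]" "[x, y, z]" 3] xyz by auto
    then show ?thesis using b unfolding bad_def lin_def set3 by (auto simp: add.assoc)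
  qed
  define f where "f x y z = c 1 x + c 2 y + c 3 z" for x y z
  have fs: "f 1 2 3 \<in> {0, 1}" "f 2 3 1 \<in> {0, 1}" "f 3 1 2 \<in> {0, 1}"
    "f 1 3 2 \<in> {0, 1}" "f 3 2 1 \<in> {0, 1}" "f 2 1 3 \<in> {0, 1}"
    unfolding f_def by (rule v; simp)+
  have bal: "f 1 2 3 + f 2 3 1 + f 3 1 2 = f 1 3 2 + f 3 2 1 + f 2 1 3" by (simp add: f_def)
  define row where "row a b \<longleftrightarrow> \<not> sensitive c a b 1 2 \<and> \<not> sensitive c a b 1 3 \<and> \<not> sensitive c a b 2 3" for a b
  define col where "col a b \<longleftrightarrow> \<not> sensitive c 1 2 a b \<and> \<not> sensitive c 1 3 a b \<and> \<not> sensitive c 2 3 a b" for a b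
  have rows: "row 1 2 \<longleftrightarrow> f 1 2 3 = f 2 1 3 \<and> f 1 3 2 = f 3 1 2 \<and> f 2 3 1 = f 3 2 1"
    "row 1 3 \<longleftrightarrow> f 1 3 2 = f 2 3 1 \<and> f 1 2 3 = f 3 2 1 \<and> f 2 1 3 = f 3 1 2"
    "row 2 3 \<longleftrightarrow> f 3 1 2 = f 3 2 1 \<and> f 2 1 3 = f 2 3 1 \<and> f 1 2 3 = f 1 3 2"
    "col 1 2 \<longleftrightarrow> f 1 2 3 = f 2 1 3 \<and> f 1 3 2 = f 2 3 1 \<and> f 3 1 2 = f 3 2 1"
    "col 1 3 \<longleftrightarrow> f 1 3 2 = f 3 1 2 \<and> f 1 2 3 = f 3 2 1 \<and> f 2 1 3 = f 2 3 1"
    "col 2 3 \<longleftrightarrow> f 2 3 1 = f 3 2 1 \<and> f 2 1 3 = f 3 1 2 \<and> f 1 2 3 = f 1 3 2"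
    by (auto simp: row_def col_def f_def sensitive_def algebra_simps)
  have "row 1 2 \<or> row 1 3 \<or> row 2 3 \<or> col 1 2 \<or> col 1 3 \<or> col 2 3"
    unfolding rows using balanced_bits[OF fs bal] by blast
  moreover have "sensitive_quads 3 c {a, b} = {}" if "row a b" for a b
    using that unfolding sensitive_quads_def set3 by (auto simp: row_def sensitive_def)
  moreover have "sensitive_quads 3 (\<lambda>a b. c b a) {a, b} = {}" if "col a b" for a b
    using that unfolding sensitive_quads_def set3 by (auto simp: col_def sensitive_def)
  moreover have "{1..3} - {3} = {1, 2::nat}" "{1..3} - {2} = {1, 3::nat}" "{1..3} - {1} = {2, 3::nat}"
    by auto
  moreover have "1 \<in> {1..3::nat}" "2 \<in> {1..3::nat}" "3 \<in> {1..3::nat}" by auto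
  ultimately show ?thesis by metis
qed

section \<open>Very small error\<close>

lemma dlists4: "[a, b, e, d] \<in> dlists n 4 \<longleftrightarrow> distinct [a, b, e, d] \<and> {a, b, e, d} \<subseteq> {1..n}"
  by (auto simp: dlists_def)

text \<open>A single pair of disjoint sensitive quadruples already accounts for (n - 4)!
  permutations in \<open>card_two_rows_le\<close>.\<close>

lemma no_disjoint_sensitive_small:
  assumes "4 * card (bad n c) < fact (n - 4)"
    and "[i, i', p, p'] \<in> dlists n 4" "[j, j', q, q'] \<in> dlists n 4"
  shows "\<not> (sensitive c i i' j j' \<and> sensitive c p p' q q')"
proof
  assume "sensitive c i i' j j' \<and> sensitive c p p' q q'"
  define V where "V = {vs \<in> dlists n 4. sensitive c i i' (vs!0) (vs!1) \<and> sensitive c p p' (vs!2) (vs!3)}"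
  have "[j, j', q, q'] \<in> V" using assms(3) \<open>sensitive c i i' j j' \<and> sensitive c p p' q q'\<close> by (simp add: V_def)
  then have "V \<noteq> {}" by blast
  then have "1 \<le> card V" by (simp add: Suc_le_eq card_gt_0_iff V_def)
  then have "1 * fact (n - 4) \<le> card V * fact (n - 4)" by (rule mult_le_mono1)
  moreover have "card V * fact (n - 4) \<le> 4 * card (bad n c)"
    using card_two_rows_le[OF assms(2), of c] by (simp add: V_def)
  ultimately show False using assms(1) by linarith
qed

text \<open>Take a sensitive quadruple \<open>Q\<close> and any further row \<open>r\<close> and column \<open>m\<close>: by the triangle inequality
  some corner \<open>(a, b)\<close> of \<open>Q\<close> forms a sensitive quadruple with \<open>(r, m)\<close>. So two disjoint sensitive
  quadruples create many pairs of disjoint ones.\<close>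

lemma no_disjoint_sensitive_large:
  assumes n: "6 \<le> n" and b: "16 * card (bad n c) < (n - 4) * (n - 5) * fact (n - 4)"
    and rows: "[i, i', p, p'] \<in> dlists n 4" and cols: "[j, j', q, q'] \<in> dlists n 4"
  shows "\<not> (sensitive c i i' j j' \<and> sensitive c p p' q q')"
proof
  assume sensitive: "sensitive c i i' j j' \<and> sensitive c p p' q q'"
  \<comment> \<open>The second difference of a quadruple is an alternating sum of those formed by
    its four corners with (r, m), so these cannot all vanish.\<close>
  have corner: "\<exists>a\<in>{i, i'}. \<exists>b\<in>{j, j'}. sensitive c a r b m" if "sensitive c i i' j j'" for i i' j j' r m
    using that by (auto simp: sensitive_def)
  have c4: "card {i, i', p, p'} = 4" "card {j, j', q, q'} = 4"
    using distinct_card[of "[i, i', p, p']"] distinct_card[of "[j, j', q, q']"] rows cols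
    by (simp_all add: dlists4 del: distinct.simps)
  define C where "C = {1..n} - {j, j', q, q'}"
  have cC: "card C = n - 4"
    unfolding C_def using cols c4 by (subst card_Diff_subset) (auto simp: dlists4)
  have cR: "card ({1..n} - {i, i', p, p'}) = n - 4"
    using rows c4 by (subst card_Diff_subset) (auto simp: dlists4)
  have ex: "\<exists>x. x \<in> A" if "card A > 0" for A :: "nat set"
    using that by (metis card.empty ex_in_conv less_irrefl)
  obtain r where r: "r \<in> {1..n} - {i, i', p, p'}"
    using ex[of "{1..n} - {i, i', p, p'}"] cR n by auto
  have "card ({1..n} - {i, i', p, p'} - {r}) = n - 5"
    using cR r n by (simp add: card_Diff_singleton)
  then obtain r1 where r1: "r1 \<in> {1..n} - {i, i', p, p'} - {r}"
    using ex[of "{1..n} - {i, i', p, p'} - {r}"] n by auto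
  \<comment> \<open>The rows r and r1 stay fixed while the further columns m and m1 vary. Every pair
    (m, m1) is recovered by \<open>pr\<close> from one of four sets \<open>V a e\<close>, and each
    set is bounded with a factor 4; hence the 16.\<close>
  define V where "V a e = {vs \<in> dlists n 4. sensitive c a r (vs!0) (vs!1) \<and> sensitive c e r1 (vs!2) (vs!3)}" for a e
  define W where "W = (SIGMA m:C. C - {m})"
  define pr where "pr vs = (vs!1, vs!3)" for vs :: "nat list"
  have finC: "finite C" by (simp add: C_def)
  have "card W = (\<Sum>m\<in>C. card (C - {m}))"
    unfolding W_def using finC by (subst card_SigmaI) auto
  also have "\<dots> = (\<Sum>m\<in>C. n - 5)"
    using cC by (intro sum.cong refl) (simp add: card_Diff_singleton)
  finally have cW: "card W = (n - 4) * (n - 5)" using cC by simp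
  have sub: "W \<subseteq> (pr ` V i p \<union> pr ` V i p') \<union> (pr ` V i' p \<union> pr ` V i' p')"
  proof
    fix w assume "w \<in> W"
    then obtain m m1 where w: "w = (m, m1)" "m \<in> C" "m1 \<in> C" "m1 \<noteq> m" by (auto simp: W_def)
    obtain a b where ab: "a \<in> {i, i'}" "b \<in> {j, j'}" "sensitive c a r b m" using corner[of i i' j j' r m] sensitive by auto
    obtain e d where ed: "e \<in> {p, p'}" "d \<in> {q, q'}" "sensitive c e r1 d m1" using corner[of p p' q q' r1 m1] sensitive by auto
    have "[b, m, d, m1] \<in> V a e"
      using w ab ed cols unfolding V_def C_def by (auto simp: dlists4)
    then have "w \<in> pr ` V a e" using w by (auto simp: pr_def image_iff intro!: bexI[of _ "[b, m, d, m1]"])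
    then show "w \<in> (pr ` V i p \<union> pr ` V i p') \<union> (pr ` V i' p \<union> pr ` V i' p')"
      using ab ed by auto
  qed
  have cV: "card (pr ` V a e) * fact (n - 4) \<le> 4 * card (bad n c)" if ae: "a \<in> {i, i'}" "e \<in> {p, p'}" for a e
  proof -
    have "[a, r, e, r1] \<in> dlists n 4" using ae r r1 rows by (auto simp: dlists4)
    from card_two_rows_le[OF this, of c] have "card (V a e) * fact (n - 4) \<le> 4 * card (bad n c)"
      by (simp add: V_def)
    moreover have "card (pr ` V a e) \<le> card (V a e)" by (rule card_image_le) (simp add: V_def)
    ultimately show ?thesis using mult_le_mono1 le_trans by blast
  qed
  have "card W \<le> card ((pr ` V i p \<union> pr ` V i p') \<union> (pr ` V i' p \<union> pr ` V i' p'))"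
    by (rule card_mono[OF _ sub]) (simp add: V_def)
  also have "\<dots> \<le> (card (pr ` V i p) + card (pr ` V i p')) + (card (pr ` V i' p) + card (pr ` V i' p'))"
    by (meson add_mono card_Un_le le_trans)
  finally have "card W * fact (n - 4) \<le> ((card (pr ` V i p) + card (pr ` V i p'))
      + (card (pr ` V i' p) + card (pr ` V i' p'))) * fact (n - 4)"
    by (rule mult_right_mono) simp
  also have "\<dots> \<le> 16 * card (bad n c)"
    using cV[of i p] cV[of i p'] cV[of i' p] cV[of i' p'] by (simp add: distrib_right)
  finally show False using b cW by simp
qed

lemma fact_ratio_4:
  assumes "4 \<le> n"
  shows "(fact n :: real) \<le> real n ^ 4 * fact (n - 4)"
proof -
  have "n = Suc (Suc (Suc (Suc (n - 4))))" using assms by simp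
  then have "fact n = n * (Suc (Suc (Suc (n - 4))) * (Suc (Suc (n - 4)) * (Suc (n - 4) * (fact (n - 4) :: nat))))"
    by (metis fact_Suc of_nat_id)
  also have "\<dots> \<le> n * (n * (n * (n * fact (n - 4))))"
    using assms by (intro mult_le_mono) auto
  finally have "fact n \<le> n ^ 4 * (fact (n - 4) :: nat)"
    by (simp add: power4_eq_xxxx mult.assoc)
  then show ?thesis by (metis of_nat_fact of_nat_le_iff of_nat_mult of_nat_power)
qed

text \<open>For n = 2 no two distinct rows remain, and for n = 3 there is less than one bad
  permutation. For n from 4 to 9 the crude count of \<open>no_disjoint_sensitive_small\<close> is
  enough; from 10 on the quadratic gain of \<open>no_disjoint_sensitive_large\<close> is
  used.\<close>

lemma exact_line:
  assumes n: "2 \<le> n" and e: "real (card (bad n c)) \<le> \<epsilon> * fact n" "\<epsilon> \<ge> 0" "\<epsilon> \<le> 1 / 20000"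
    and small: "10 \<le> n \<Longrightarrow> 64 * (real n)\<^sup>2 * \<epsilon> < 1"
  shows "(\<exists>i\<in>{1..n}. sensitive_quads n c ({1..n} - {i}) = {}) \<or>
         (\<exists>j\<in>{1..n}. sensitive_quads n (\<lambda>a b. c b a) ({1..n} - {j}) = {})"
proof -
  consider "n = 2" | "n = 3" | "4 \<le> n" "n \<le> 9" | "10 \<le> n" using n by linarith
  then show ?thesis
  proof cases
    case 1
    have "sensitive_quads n c ({1..n} - {1}) = {}"
      using 1 sensitive_distinct by (fastforce simp: sensitive_quads_def)
    then show ?thesis using 1 by auto
  next
    case 2
    have "\<epsilon> * fact n < 1" using 2 e(3) by (simp add: fact_numeral)
    then have "card (bad n c) = 0" using e(1) by linarith
    then have "bad n c = {}" by (simp add: bad_def)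
    then show ?thesis using common_line_3 2 by simp
  next
    case 3
    have n: "n = 4 \<or> n = 5 \<or> n = 6 \<or> n = 7 \<or> n = 8 \<or> n = 9" using 3 by linarith
    \<comment> \<open>The largest ratio n! / (n - 4)! in this range is 9 * 8 * 7 * 6 = 3024, and 4 *
      3024 < 20000.\<close>
    have f: "(fact n :: real) \<le> 3024 * fact (n - 4)"
      using n by (elim disjE) (simp_all add: fact_numeral)
    have "4 * real (card (bad n c)) \<le> 4 * (\<epsilon> * fact n)" using e(1) by simp
    also have "\<dots> \<le> 4 * (1 / 20000 * (3024 * fact (n - 4)))"
      using e f by (intro mult_left_mono mult_mono) auto
    also have "\<dots> < fact (n - 4)" by simp
    finally have "real (4 * card (bad n c)) < real (fact (n - 4))" by simp
    then have "4 * card (bad n c) < fact (n - 4)" by (simp only: of_nat_less_iff)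
    from common_line[OF 3(1) no_disjoint_sensitive_small[OF this]] show ?thesis by blast
  next
    case 4
    define m where "m = n - 4"
    have m: "n = m + 4" "6 \<le> m" using 4 by (auto simp: m_def)
    have f: "(fact n :: real) \<le> real n ^ 4 * fact m"
      using fact_ratio_4[of n] 4 by (simp add: m_def)
    \<comment> \<open>This inequality sets the threshold n = 10: it fails for m = 5, where 81 >
      80.\<close>
    have q: "(real n)\<^sup>2 \<le> 4 * (real m * (real m - 1))"
    proof -
      have "0 \<le> (real m - 6) * (3 * real m + 6) + 20" using m(2) by simp
      then show ?thesis by (simp add: m power2_eq_square algebra_simps)
    qed
    have np: "0 < (real n)\<^sup>2" using 4 by simp
    have "16 * real (card (bad n c)) \<le> 16 * (\<epsilon> * (real n ^ 4 * fact m))"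
      using e(1) mult_left_mono[OF f e(2)] by linarith
    also have "\<dots> = (64 * (real n)\<^sup>2 * \<epsilon>) * ((real n)\<^sup>2 / 4 * fact m)"
      by (simp add: power2_eq_square power4_eq_xxxx)
    also have "\<dots> < 1 * ((real n)\<^sup>2 / 4 * fact m)"
      using small[OF 4] np by (intro mult_strict_right_mono) auto
    also have "\<dots> \<le> real m * (real m - 1) * fact m"
      unfolding mult_1 by (rule mult_right_mono) (use q in linarith, simp)
    also have "\<dots> = real ((n - 4) * (n - 5) * fact (n - 4))"
      using m by (simp add: of_nat_diff)
    finally have "real (16 * card (bad n c)) < real ((n - 4) * (n - 5) * fact (n - 4))"
      by (simp only: of_nat_mult of_nat_numeral)
    then have b: "16 * card (bad n c) < (n - 4) * (n - 5) * fact (n - 4)" by (simp only: of_nat_less_iff)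
    have n: "4 \<le> n" "6 \<le> n" using 4 by auto
    show ?thesis by (rule common_line[OF n(1) no_disjoint_sensitive_large[OF n(2) b]])
  qed
qed

section \<open>Moments of a random matching\<close>

type_synonym quad = "nat \<times> nat \<times> nat \<times> nat"

text \<open>A random matching is encoded by two independent permutations,
  \<open>fst \<omega>\<close> ordering the rows and \<open>snd \<omega>\<close> the columns. Its
  quadruple number k is read off at block k.\<close>

definition quad_at :: "(nat \<Rightarrow> nat) \<times> (nat \<Rightarrow> nat) \<Rightarrow> nat \<Rightarrow> quad" where
  "quad_at \<omega> k = (fst \<omega> (2*k+1), fst \<omega> (2*k+2), snd \<omega> (2*k+1), snd \<omega> (2*k+2))"

definition Sym2 :: "nat \<Rightarrow> ((nat \<Rightarrow> nat) \<times> (nat \<Rightarrow> nat)) set" where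
  "Sym2 n = Sym n \<times> Sym n"

definition meets :: "quad \<Rightarrow> quad \<Rightarrow> bool" where
  "meets = (\<lambda>(i, i', j, j') (r, r', m, m'). {i, i'} \<inter> {r, r'} \<noteq> {} \<or> {j, j'} \<inter> {m, m'} \<noteq> {})"

lemma finite_Sym2 [simp]: "finite (Sym2 n)"
  by (simp add: Sym2_def)

lemma quad_at_sensitive_iff:
  assumes "\<omega> \<in> Sym2 n" "2 * k + 2 \<le> n"
  shows "quad_at \<omega> k \<in> sensitive_quads n c {1..n} \<longleftrightarrow> active (\<lambda>i. c (fst \<omega> i)) (snd \<omega>) k"
proof -
  obtain \<sigma> \<pi> where w: "\<omega> = (\<sigma>, \<pi>)" "\<sigma> \<in> Sym n" "\<pi> \<in> Sym n" using assms(1) by (auto simp: Sym2_def)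
  have "2 * k + 1 \<in> {1..n}" "2 * k + 2 \<in> {1..n}" using assms(2) by auto
  then show ?thesis
    using Sym_in[OF w(2)] Sym_in[OF w(3)] by (simp add: w(1) quad_at_def sensitive_quads_def active_def sensitive_def)
qed

text \<open>For a fixed order of the rows this is \<open>card_two_active_le\<close> for the
  relabelled array. The predicate \<open>P\<close> allows conditioning on the order of the rows, as
  is done later with a prescribed first row.\<close>

lemma card_two_sensitive_le:
  assumes "2 * T \<le> n"
  shows "card {\<omega> \<in> Sym2 n. P (fst \<omega>) \<and> (\<exists>k<T. \<exists>l<T. k \<noteq> l \<and> quad_at \<omega> k \<in> sensitive_quads n c {1..n}
            \<and> quad_at \<omega> l \<in> sensitive_quads n c {1..n})}
       \<le> card {\<sigma> \<in> Sym n. P \<sigma>} * (4 * card (bad n c))"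
proof -
  define B where "B \<sigma> = {\<pi> \<in> Sym n. \<exists>k<T. \<exists>l<T. k \<noteq> l \<and> active (\<lambda>i. c (\<sigma> i)) \<pi> k \<and> active (\<lambda>i. c (\<sigma> i)) \<pi> l}" for \<sigma>
  have iff: "quad_at (\<sigma>, \<pi>) k \<in> sensitive_quads n c {1..n} \<longleftrightarrow> active (\<lambda>i. c (\<sigma> i)) \<pi> k"
    if "\<sigma> \<in> Sym n" "\<pi> \<in> Sym n" "k < T" for \<sigma> \<pi> k
    using quad_at_sensitive_iff[of "(\<sigma>, \<pi>)" n k c] that assms by (simp add: Sym2_def)
  have "{\<omega> \<in> Sym2 n. P (fst \<omega>) \<and> (\<exists>k<T. \<exists>l<T. k \<noteq> l \<and> quad_at \<omega> k \<in> sensitive_quads n c {1..n}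
            \<and> quad_at \<omega> l \<in> sensitive_quads n c {1..n})} = (SIGMA \<sigma>:{\<sigma> \<in> Sym n. P \<sigma>}. B \<sigma>)"
    unfolding B_def Sym2_def using iff by (fastforce simp del: atLeastAtMost_iff)
  then have "card {\<omega> \<in> Sym2 n. P (fst \<omega>) \<and> (\<exists>k<T. \<exists>l<T. k \<noteq> l \<and> quad_at \<omega> k \<in> sensitive_quads n c {1..n}
            \<and> quad_at \<omega> l \<in> sensitive_quads n c {1..n})} = (\<Sum>\<sigma>\<in>{\<sigma> \<in> Sym n. P \<sigma>}. card (B \<sigma>))"
    by (simp add: card_SigmaI B_def)
  also have "\<dots> \<le> (\<Sum>\<sigma>\<in>{\<sigma> \<in> Sym n. P \<sigma>}. 4 * card (bad n c))"
  proof (rule sum_mono)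
    fix \<sigma> assume "\<sigma> \<in> {\<sigma> \<in> Sym n. P \<sigma>}"
    then show "card (B \<sigma>) \<le> 4 * card (bad n c)"
      using card_two_active_le[OF assms, of "\<lambda>i. c (\<sigma> i)"] card_bad_relabel[of \<sigma> n c] by (simp add: B_def)
  qed
  finally show ?thesis by simp
qed

text \<open>Non-meeting quadruples concatenate to tuples of four distinct rows and four distinct
  columns, and each such pair of tuples is attained by ((n - 4)!)^2 matchings.\<close>

lemma card_quads_2_ge:
  assumes kl: "k \<noteq> l" "2 * k + 2 \<le> n" "2 * l + 2 \<le> n"
    and XY: "X \<subseteq> sensitive_quads n c {1..n}" "Y \<subseteq> sensitive_quads n c {1..n}"
  shows "card {(Q, Q') \<in> X \<times> Y. \<not> meets Q Q'} * (fact (n - 4))\<^sup>2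
       \<le> card {\<omega> \<in> Sym2 n. quad_at \<omega> k \<in> X \<and> quad_at \<omega> l \<in> Y}"
proof -
  define xs where "xs = [2*k+1, 2*k+2, 2*l+1, 2*l+2]"
  have ne: "2*k+1 \<noteq> 2*l+1" "2*k+1 \<noteq> 2*l+2" "2*k+2 \<noteq> 2*l+1" "2*k+2 \<noteq> 2*l+2"
    using kl(1) by presburger+
  have xs: "xs \<in> dlists n 4" using kl ne unfolding xs_def dlists4 by auto
  define P where "P us vs \<longleftrightarrow> (us!0, us!1, vs!0, vs!1) \<in> X \<and> (us!2, us!3, vs!2, vs!3) \<in> Y" for us vs :: "nat list"
  define h :: "quad \<times> quad \<Rightarrow> nat list \<times> nat list" where
    "h = (\<lambda>((i, i', j, j'), (r, r', m, m')). ([i, i', r, r'], [j, j', m, m']))"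
  have "card {(Q, Q') \<in> X \<times> Y. \<not> meets Q Q'} \<le> card {(us, vs) \<in> dlists n 4 \<times> dlists n 4. P us vs}"
  proof (rule card_inj_on_le[of h])
    show "inj_on h {(Q, Q') \<in> X \<times> Y. \<not> meets Q Q'}" by (auto simp: inj_on_def h_def)
    show "finite {(us, vs) \<in> dlists n 4 \<times> dlists n 4. P us vs}"
      by (rule finite_subset[of _ "dlists n 4 \<times> dlists n 4"]) auto
    show "h ` {(Q, Q') \<in> X \<times> Y. \<not> meets Q Q'} \<subseteq> {(us, vs) \<in> dlists n 4 \<times> dlists n 4. P us vs}"
    proof
      fix y assume "y \<in> h ` {(Q, Q') \<in> X \<times> Y. \<not> meets Q Q'}"
      then obtain i i' j j' r r' m m' where q: "(i, i', j, j') \<in> X" "(r, r', m, m') \<in> Y"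
        "\<not> meets (i, i', j, j') (r, r', m, m')" "y = ([i, i', r, r'], [j, j', m, m'])"
        by (auto simp: h_def)
      have "(i, i', j, j') \<in> sensitive_quads n c {1..n}" "(r, r', m, m') \<in> sensitive_quads n c {1..n}"
        using q XY by auto
      then have "distinct [i, i', r, r']" "distinct [j, j', m, m']" "{i, i', r, r'} \<subseteq> {1..n}" "{j, j', m, m'} \<subseteq> {1..n}"
        using q(3) sensitive_distinct[of c i i' j j'] sensitive_distinct[of c r r' m m']
        by (auto simp: sensitive_quads_def meets_def)
      then show "y \<in> {(us, vs) \<in> dlists n 4 \<times> dlists n 4. P us vs}"
        using q by (simp add: P_def dlists4 del: distinct.simps)
    qed
  qed
  then have "card {(Q, Q') \<in> X \<times> Y. \<not> meets Q Q'} * (fact (n - 4))\<^sup>2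
      \<le> card {(us, vs) \<in> dlists n 4 \<times> dlists n 4. P us vs} * (fact (n - 4))\<^sup>2"
    by (rule mult_le_mono1)
  also have "\<dots> = card {(\<sigma>, \<pi>) \<in> Sym n \<times> Sym n. P (map \<sigma> xs) (map \<pi> xs)}"
    by (rule card_Sym_map2[OF xs, symmetric])
  also have "{(\<sigma>, \<pi>) \<in> Sym n \<times> Sym n. P (map \<sigma> xs) (map \<pi> xs)} = {\<omega> \<in> Sym2 n. quad_at \<omega> k \<in> X \<and> quad_at \<omega> l \<in> Y}"
    by (auto simp: P_def xs_def quad_at_def Sym2_def numeral_eq_Suc)
  finally show ?thesis .
qed

text \<open>For an upper bound the three quadruples may be chosen freely, without regard to whether
  they meet.\<close>

lemma card_quads_3_le:
  assumes klm: "distinct [k, l, m]" "2 * k + 2 \<le> n" "2 * l + 2 \<le> n" "2 * m + 2 \<le> n"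
    and fin: "finite X" "finite Y" "finite Z"
  shows "card {\<omega> \<in> Sym2 n. quad_at \<omega> k \<in> X \<and> quad_at \<omega> l \<in> Y \<and> quad_at \<omega> m \<in> Z}
       \<le> card X * card Y * card Z * (fact (n - 6))\<^sup>2"
proof -
  define xs where "xs = [2*k+1, 2*k+2, 2*l+1, 2*l+2, 2*m+1, 2*m+2]"
  have ne: "2*a+1 \<noteq> 2*b+1" "2*a+1 \<noteq> 2*b+2" "2*a+2 \<noteq> 2*b+1" "2*a+2 \<noteq> 2*b+2" if "a \<noteq> b" for a b :: nat
    using that by presburger+
  have "distinct xs" unfolding xs_def using klm(1) ne[of k l] ne[of k m] ne[of l m] by auto
  then have xs: "xs \<in> dlists n 6" using klm unfolding dlists_def xs_def by auto
  define P where "P us vs \<longleftrightarrow> (us!0, us!1, vs!0, vs!1) \<in> X \<and> (us!2, us!3, vs!2, vs!3) \<in> Y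
      \<and> (us!4, us!5, vs!4, vs!5) \<in> Z" for us vs :: "nat list"
  define h :: "nat list \<times> nat list \<Rightarrow> quad \<times> quad \<times> quad" where
    "h = (\<lambda>(us, vs). ((us!0, us!1, vs!0, vs!1), (us!2, us!3, vs!2, vs!3), (us!4, us!5, vs!4, vs!5)))"
  have "card {(us, vs) \<in> dlists n 6 \<times> dlists n 6. P us vs} \<le> card (X \<times> Y \<times> Z)"
  proof (rule card_inj_on_le[of h])
    have l6: "us = [us!0, us!1, us!2, us!3, us!4, us!5]" if "us \<in> dlists n 6" for us
      using that by (auto simp: dlists_def numeral_eq_Suc length_Suc_conv)
    show "inj_on h {(us, vs) \<in> dlists n 6 \<times> dlists n 6. P us vs}"
    proof (rule inj_onI, clarify)
      fix us vs us' vs'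
      assume "us \<in> dlists n 6" "vs \<in> dlists n 6" "us' \<in> dlists n 6" "vs' \<in> dlists n 6" "h (us, vs) = h (us', vs')"
      then show "us = us' \<and> vs = vs'"
        using l6[of us] l6[of vs] l6[of us'] l6[of vs'] by (simp add: h_def)
    qed
    show "h ` {(us, vs) \<in> dlists n 6 \<times> dlists n 6. P us vs} \<subseteq> X \<times> Y \<times> Z" by (auto simp: h_def P_def)
  qed (use fin in auto)
  then have le: "card {(us, vs) \<in> dlists n 6 \<times> dlists n 6. P us vs} \<le> card X * card Y * card Z"
    by (simp add: card_cartesian_product mult.assoc)
  have "{\<omega> \<in> Sym2 n. quad_at \<omega> k \<in> X \<and> quad_at \<omega> l \<in> Y \<and> quad_at \<omega> m \<in> Z}
      = {(\<sigma>, \<pi>) \<in> Sym n \<times> Sym n. P (map \<sigma> xs) (map \<pi> xs)}"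
    by (auto simp: P_def xs_def quad_at_def Sym2_def numeral_eq_Suc)
  then show ?thesis
    using card_Sym_map2[OF xs, of P] mult_le_mono1[OF le, of "(fact (n - 6))\<^sup>2"] by simp
qed

section \<open>Factorial moments of sums of indicators\<close>

lemma sum_distinct_pairs:
  fixes z :: "'a \<Rightarrow> bool"
  assumes "finite I"
  defines "N \<equiv> (\<Sum>k\<in>I. of_bool (z k) :: real)"
  shows "(\<Sum>k\<in>I. \<Sum>l\<in>I - {k}. of_bool (z k \<and> z l)) = N * (N - 1)"
proof -
  have "(\<Sum>l\<in>I - {k}. of_bool (z k \<and> z l) :: real) = of_bool (z k) * (N - 1)" if "k \<in> I" for k
  proof -
    have "(\<Sum>l\<in>I - {k}. of_bool (z k \<and> z l) :: real) = of_bool (z k) * (\<Sum>l\<in>I - {k}. of_bool (z l))"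
      by (simp only: of_bool_conj sum_distrib_left)
    also have "\<dots> = of_bool (z k) * (N - of_bool (z k))"
      using sum_diff1[OF assms(1), of "\<lambda>l. of_bool (z l) :: real" k] that by (simp only: N_def if_True)
    finally show ?thesis by (cases "z k") simp_all
  qed
  then have "(\<Sum>k\<in>I. \<Sum>l\<in>I - {k}. of_bool (z k \<and> z l)) = (\<Sum>k\<in>I. of_bool (z k) * (N - 1))"
    by (intro sum.cong refl)
  also have "\<dots> = N * (N - 1)" by (simp only: N_def sum_distrib_right)
  finally show ?thesis .
qed

lemma sum_distinct_triples:
  fixes z :: "'a \<Rightarrow> bool"
  assumes "finite I"
  defines "N \<equiv> (\<Sum>k\<in>I. of_bool (z k) :: real)"
  shows "(\<Sum>k\<in>I. \<Sum>l\<in>I - {k}. \<Sum>m\<in>I - {k, l}. of_bool (z k \<and> z l \<and> z m)) = N * (N - 1) * (N - 2)"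
proof -
  have "(\<Sum>m\<in>I - {k, l}. of_bool (z k \<and> z l \<and> z m) :: real) = of_bool (z k \<and> z l) * (N - 2)"
    if "k \<in> I" "l \<in> I - {k}" for k l
  proof -
    have "(\<Sum>m\<in>I - {k, l}. of_bool (z k \<and> z l \<and> z m) :: real)
        = of_bool (z k \<and> z l) * (\<Sum>m\<in>I - {k} - {l}. of_bool (z m))"
      by (simp only: of_bool_conj sum_distrib_left mult.assoc Diff_insert[of I l "{k}"] insert_commute[of k l "{}"])
    also have "(\<Sum>m\<in>I - {k} - {l}. of_bool (z m) :: real) = N - of_bool (z k) - of_bool (z l)"
      using sum_diff1[OF assms(1), of "\<lambda>l. of_bool (z l) :: real" k]
        sum_diff1[of "I - {k}" "\<lambda>l. of_bool (z l) :: real" l] assms(1) that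
      by (simp only: N_def if_True finite_Diff)
    finally show ?thesis by (cases "z k"; cases "z l") simp_all
  qed
  then have "(\<Sum>k\<in>I. \<Sum>l\<in>I - {k}. \<Sum>m\<in>I - {k, l}. of_bool (z k \<and> z l \<and> z m)) 
      = (\<Sum>k\<in>I. \<Sum>l\<in>I - {k}. of_bool (z k \<and> z l) * (N - 2))"
    by (intro sum.cong refl)
  also have "\<dots> = N * (N - 1) * (N - 2)"
    using sum_distinct_pairs[OF assms(1), of z] by (simp add: N_def sum_distrib_right[symmetric])
  finally show ?thesis .
qed

lemma sum_of_bool_card: "finite S \<Longrightarrow> (\<Sum>\<omega>\<in>S. of_bool (P \<omega>) :: real) = card {\<omega> \<in> S. P \<omega>}"
  by (simp add: of_bool_def sum.If_cases Int_def)

lemma fact_ratio_6: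
  assumes "250 \<le> n"
  shows "real n ^ 12 * (fact (n - 6))\<^sup>2 \<le> 2 * (fact n)\<^sup>2"
proof -
  have x6: "x ^ 6 * y = x * (x * (x * (x * (x * (x * y)))))" for x y :: nat
    by (simp add: numeral_eq_Suc)
  define m where "m = n - 6"
  have "n = Suc (Suc (Suc (Suc (Suc (Suc m)))))" using assms by (simp add: m_def)
  then have "fact n = n * (Suc (Suc (Suc (Suc (Suc m)))) * (Suc (Suc (Suc (Suc m))) * (Suc (Suc (Suc m)) * (Suc (Suc m) * (Suc m * (fact m :: nat))))))"
    by (metis fact_Suc of_nat_id)
  moreover have "Suc m * (Suc m * (Suc m * (Suc m * (Suc m * (Suc m * fact m))))) \<le> \<dots>"
    using assms by (intro mult_le_mono) (auto simp: m_def)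
  ultimately have "Suc m ^ 6 * fact m \<le> (fact n :: nat)"
    by (simp only: x6)
  then have a: "real (Suc m) ^ 6 * fact m \<le> fact n" by (metis of_nat_fact of_nat_le_iff of_nat_mult of_nat_power)
  \<comment> \<open>Here \<open>Suc m\<close> is n - 5, and n - 5 >= 49/50 n holds exactly from n =
    250 on. The power (49/50)^12 is still above 1/2.\<close>
  have b: "49 / 50 * real n \<le> real (Suc m)" using assms by (simp add: m_def of_nat_diff)
  have "(49 / 50 * real n) ^ 6 * fact m \<le> real (Suc m) ^ 6 * fact m"
    by (intro mult_right_mono power_mono b) auto
  with a have "(49 / 50 * real n) ^ 6 * fact m \<le> fact n" by linarith
  then have "((49 / 50 * real n) ^ 6 * fact m)\<^sup>2 \<le> (fact n)\<^sup>2"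
    by (rule power_mono) auto
  moreover have "((p * r) ^ 6 * u)\<^sup>2 = p ^ 12 * (r ^ 12 * u\<^sup>2)" for p r u :: real
    by (simp add: power_mult_distrib power_mult[symmetric])
  ultimately have "(49 / 50) ^ 12 * (real n ^ 12 * (fact m)\<^sup>2) \<le> (fact n)\<^sup>2"
    by (simp only:)
  moreover have "(1 / 2) * (real n ^ 12 * (fact m)\<^sup>2) \<le> (49 / 50) ^ 12 * (real n ^ 12 * (fact m)\<^sup>2)"
    by (rule mult_right_mono) (simp_all add: power_divide)
  ultimately show ?thesis by (simp add: m_def)
qed

lemma card_not_meets:
  assumes fin: "finite X" "finite Y"
    and half: "\<And>Q'. Q' \<in> Y \<Longrightarrow> 2 * card {Q \<in> X. meets Q Q'} \<le> card X"
  shows "card X * card Y \<le> 2 * card {(Q, Q') \<in> X \<times> Y. \<not> meets Q Q'}"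
proof -
  have "card {(Q, Q') \<in> X \<times> Y. \<not> meets Q Q'} = card (SIGMA Q':Y. {Q \<in> X. \<not> meets Q Q'})"
    by (rule bij_betw_same_card[of prod.swap]) (auto simp: bij_betw_def inj_on_def image_iff)
  also have "\<dots> = (\<Sum>Q'\<in>Y. card {Q \<in> X. \<not> meets Q Q'})"
    using fin by (simp add: card_SigmaI)
  finally have eq: "card {(Q, Q') \<in> X \<times> Y. \<not> meets Q Q'} = (\<Sum>Q'\<in>Y. card {Q \<in> X. \<not> meets Q Q'})" .
  have "card X \<le> 2 * card {Q \<in> X. \<not> meets Q Q'}" if "Q' \<in> Y" for Q'
  proof -
    have "card X = card ({Q \<in> X. meets Q Q'} \<union> {Q \<in> X. \<not> meets Q Q'})"
      by (rule arg_cong[where f = card]) auto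
    also have "\<dots> = card {Q \<in> X. meets Q Q'} + card {Q \<in> X. \<not> meets Q Q'}"
      using fin by (intro card_Un_disjoint) auto
    finally show ?thesis using half[OF that] by linarith
  qed
  then have "(\<Sum>Q'\<in>Y. card X) \<le> (\<Sum>Q'\<in>Y. 2 * card {Q \<in> X. \<not> meets Q Q'})"
    by (rule sum_mono)
  then show ?thesis unfolding eq sum_distrib_left by (simp add: mult.commute)
qed

lemma card_second_row: "card {Q \<in> sensitive_quads n c R. fst (snd Q) = i} = card {Q \<in> sensitive_quads n c R. fst Q = i}"
  by (rule bij_betw_same_card[of "\<lambda>(r, l, j, j'). (l, r, j, j')"],
      rule bij_betw_byWitness[where f' = "\<lambda>(r, l, j, j'). (l, r, j, j')"])
     (auto simp: sensitive_quads_def sensitive_swap_rows)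

lemma card_second_col: "card {Q \<in> sensitive_quads n c R. snd (snd (snd Q)) = j} = card {Q \<in> sensitive_quads n c R. fst (snd (snd Q)) = j}"
  by (rule bij_betw_same_card[of "\<lambda>(r, l, j, j'). (r, l, j', j)"],
      rule bij_betw_byWitness[where f' = "\<lambda>(r, l, j, j'). (r, l, j', j)"])
     (auto simp: sensitive_quads_def sensitive_swap_cols)

lemma sum_pairs_of_bool:
  assumes "finite S" "finite I"
  shows "(\<Sum>\<omega>\<in>S. (\<Sum>k\<in>I. of_bool (z \<omega> k) :: real) * ((\<Sum>k\<in>I. of_bool (z \<omega> k)) - 1))
       = (\<Sum>k\<in>I. \<Sum>l\<in>I - {k}. real (card {\<omega> \<in> S. z \<omega> k \<and> z \<omega> l}))"
proof -
  have "(\<Sum>\<omega>\<in>S. (\<Sum>k\<in>I. of_bool (z \<omega> k) :: real) * ((\<Sum>k\<in>I. of_bool (z \<omega> k)) - 1))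
      = (\<Sum>\<omega>\<in>S. \<Sum>k\<in>I. \<Sum>l\<in>I - {k}. of_bool (z \<omega> k \<and> z \<omega> l))"
    by (intro sum.cong refl sum_distinct_pairs[symmetric] assms)
  also have "\<dots> = (\<Sum>k\<in>I. \<Sum>\<omega>\<in>S. \<Sum>l\<in>I - {k}. of_bool (z \<omega> k \<and> z \<omega> l))"
    by (rule sum.swap)
  also have "\<dots> = (\<Sum>k\<in>I. \<Sum>l\<in>I - {k}. \<Sum>\<omega>\<in>S. of_bool (z \<omega> k \<and> z \<omega> l))"
    by (intro sum.cong refl sum.swap)
  finally show ?thesis using assms by (simp only: sum_of_bool_card)
qed

lemma sum_triples_of_bool:
  assumes "finite S" "finite I"
  shows "(\<Sum>\<omega>\<in>S. (\<Sum>k\<in>I. of_bool (z \<omega> k) :: real) * ((\<Sum>k\<in>I. of_bool (z \<omega> k)) - 1) * ((\<Sum>k\<in>I. of_bool (z \<omega> k)) - 2))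
       = (\<Sum>k\<in>I. \<Sum>l\<in>I - {k}. \<Sum>m\<in>I - {k, l}. real (card {\<omega> \<in> S. z \<omega> k \<and> z \<omega> l \<and> z \<omega> m}))"
proof -
  have "(\<Sum>\<omega>\<in>S. (\<Sum>k\<in>I. of_bool (z \<omega> k) :: real) * ((\<Sum>k\<in>I. of_bool (z \<omega> k)) - 1) * ((\<Sum>k\<in>I. of_bool (z \<omega> k)) - 2))
      = (\<Sum>\<omega>\<in>S. \<Sum>k\<in>I. \<Sum>l\<in>I - {k}. \<Sum>m\<in>I - {k, l}. of_bool (z \<omega> k \<and> z \<omega> l \<and> z \<omega> m))"
    by (intro sum.cong refl sum_distinct_triples[symmetric] assms)
  also have "\<dots> = (\<Sum>k\<in>I. \<Sum>\<omega>\<in>S. \<Sum>l\<in>I - {k}. \<Sum>m\<in>I - {k, l}. of_bool (z \<omega> k \<and> z \<omega> l \<and> z \<omega> m))"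
    by (rule sum.swap)
  also have "\<dots> = (\<Sum>k\<in>I. \<Sum>l\<in>I - {k}. \<Sum>\<omega>\<in>S. \<Sum>m\<in>I - {k, l}. of_bool (z \<omega> k \<and> z \<omega> l \<and> z \<omega> m))"
    by (intro sum.cong refl sum.swap)
  also have "\<dots> = (\<Sum>k\<in>I. \<Sum>l\<in>I - {k}. \<Sum>m\<in>I - {k, l}. \<Sum>\<omega>\<in>S. of_bool (z \<omega> k \<and> z \<omega> l \<and> z \<omega> m))"
    by (intro sum.cong refl sum.swap)
  finally show ?thesis using assms by (simp only: sum_of_bool_card)
qed

lemma fact_ratio_4_sq:
  assumes "250 \<le> n"
  shows "(fact n)\<^sup>2 / real n ^ 8 \<le> (fact (n - 4))\<^sup>2"
proof -
  have "(fact n :: real)\<^sup>2 \<le> (real n ^ 4 * fact (n - 4))\<^sup>2"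
    using assms by (intro power_mono fact_ratio_4) auto
  also have "\<dots> = real n ^ 8 * (fact (n - 4))\<^sup>2"
    by (simp add: power_mult_distrib power_mult[symmetric])
  finally show ?thesis using assms by (simp add: divide_le_eq mult.commute)
qed

lemma fact_ratio_6_sq:
  assumes "250 \<le> n"
  shows "(fact (n - 6))\<^sup>2 \<le> 2 * (fact n)\<^sup>2 / real n ^ 12"
  using fact_ratio_6[OF assms] assms by (simp add: le_divide_eq mult.commute)

text \<open>Since no line is popular, most pairs of sensitive quadruples are disjoint, so the number \<open>N\<close>
  of active pairs in a random matching of size \<open>T\<close> has a large second factorial moment. Comparison with the third moment shows that \<open>N \<ge> 2\<close> is likely.\<close>

lemma spread_imp_small:
  assumes n: "250 \<le> n" and b: "real (card (bad n c)) \<le> \<epsilon> * fact n"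
    and A: "A = sensitive_quads n c {1..n}" "A \<noteq> {}"
    and rows: "\<And>i. 16 * card {Q \<in> A. fst Q = i} \<le> card A"
    and cols: "\<And>j. 16 * card {Q \<in> A. fst (snd (snd Q)) = j} \<le> card A"
    and x: "x = real (n div 2) * card A / real n ^ 4"
  shows "x\<^sup>2 \<le> 32 * \<epsilon> * (2 + 16 * x)\<^sup>2"
proof -
  have finA: "finite A" using A by simp
  define T where "T = n div 2"
  have T: "2 * T \<le> n" "2 \<le> T" using n by (auto simp: T_def)
  define a where "a = real (card A)"
  have a: "a > 0" using A(2) finA by (simp add: a_def card_gt_0_iff)
  have xa: "x = real T * a / real n ^ 4" by (simp add: x T_def a_def)
  have x0: "x > 0" using a T n by (simp add: xa)
  define D where "D = real (card {(Q, Q') \<in> A \<times> A. \<not> meets Q Q'})"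
  \<comment> \<open>A quadruple meeting Q' has one of the two rows or columns of Q' in one of its
    positions: eight events, each of proportion at most 1/16.\<close>
  have "2 * card {Q \<in> A. meets Q Q'} \<le> card A" for Q'
  proof -
    obtain r r' m m' where Q': "Q' = (r, r', m, m')" by (cases Q') auto
    define X1 where "X1 i = {Q \<in> A. fst Q = i}" for i
    define X2 where "X2 i = {Q \<in> A. fst (snd Q) = i}" for i
    define X3 where "X3 j = {Q \<in> A. fst (snd (snd Q)) = j}" for j
    define X4 where "X4 j = {Q \<in> A. snd (snd (snd Q)) = j}" for j
    have c: "16 * card (X1 i) \<le> card A" "16 * card (X2 i) \<le> card A" "16 * card (X3 i) \<le> card A" "16 * card (X4 i) \<le> card A" for i
      using rows[of i] cols[of i] card_second_row[of n c "{1..n}" i] card_second_col[of n c "{1..n}" i]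
      unfolding A X1_def X2_def X3_def X4_def by simp_all
    have "{Q \<in> A. meets Q Q'} \<subseteq> ((X1 r \<union> X1 r') \<union> (X2 r \<union> X2 r')) \<union> ((X3 m \<union> X3 m') \<union> (X4 m \<union> X4 m'))"
      unfolding Q' X1_def X2_def X3_def X4_def meets_def by auto
    then have "card {Q \<in> A. meets Q Q'} \<le> card (((X1 r \<union> X1 r') \<union> (X2 r \<union> X2 r')) \<union> ((X3 m \<union> X3 m') \<union> (X4 m \<union> X4 m')))"
      by (rule card_mono[rotated]) (auto simp: X1_def X2_def X3_def X4_def finA)
    also have "\<dots> \<le> ((card (X1 r) + card (X1 r')) + (card (X2 r) + card (X2 r')))
        + ((card (X3 m) + card (X3 m')) + (card (X4 m) + card (X4 m')))"
      by (intro order_trans[OF card_Un_le] add_mono card_Un_le order_refl)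
    finally show ?thesis
      using c[of r] c[of r'] c[of m] c[of m'] by linarith
  qed
  then have "card A * card A \<le> 2 * card {(Q, Q') \<in> A \<times> A. \<not> meets Q Q'}"
    by (intro card_not_meets finA)
  then have "real (card A * card A) \<le> real (2 * card {(Q, Q') \<in> A \<times> A. \<not> meets Q Q'})"
    by (simp only: of_nat_le_iff)
  then have D: "a\<^sup>2 / 2 \<le> D" by (simp add: a_def D_def power2_eq_square)
  define z where "z \<omega> k \<longleftrightarrow> quad_at \<omega> k \<in> A" for \<omega> k
  define N where "N \<omega> = (\<Sum>k\<in>{..<T}. of_bool (z \<omega> k) :: real)" for \<omega>
  define G where "G = {\<omega> \<in> Sym2 n. \<exists>k<T. \<exists>l<T. k \<noteq> l \<and> z \<omega> k \<and> z \<omega> l}"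
  \<comment> \<open>The mean of N is of order x. Beyond M the third factorial moment, divided by 16
    x, dominates the second.\<close>
  define M where "M = 2 + 16 * x"
  have cG: "real (card G) \<le> 4 * \<epsilon> * (fact n)\<^sup>2"
  proof -
    have "card G \<le> card (Sym n) * (4 * card (bad n c))"
      using card_two_sensitive_le[OF T(1), of "\<lambda>_. True" c] by (simp add: G_def z_def A)
    then have "real (card G) \<le> real (fact n * (4 * card (bad n c)))"
      unfolding card_Sym by (simp only: of_nat_le_iff)
    also have "\<dots> \<le> fact n * (4 * (\<epsilon> * fact n))" using b by simp
    finally show ?thesis by (simp add: power2_eq_square mult.assoc mult.left_commute)
  qed
  \<comment> \<open>If at most one pair is active, the left side is 0. For 2 <= N <= M it is at most
    M^2, and for N > M the factor (N - 2) / (16 x) exceeds 1.\<close>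
  have point: "N \<omega> * (N \<omega> - 1) \<le> M\<^sup>2 * of_bool (\<exists>k<T. \<exists>l<T. k \<noteq> l \<and> z \<omega> k \<and> z \<omega> l)
      + N \<omega> * (N \<omega> - 1) * (N \<omega> - 2) / (16 * x)" for \<omega>
  proof -
    have Nc: "N \<omega> = real (card {k. k < T \<and> z \<omega> k})"
      using sum_of_bool_card[of "{..<T}" "z \<omega>"] by (simp add: N_def)
    show ?thesis
    proof (cases "\<exists>k<T. \<exists>l<T. k \<noteq> l \<and> z \<omega> k \<and> z \<omega> l")
      case False
      then have "card {k. k < T \<and> z \<omega> k} \<le> Suc 0"
        by (subst card_le_Suc0_iff_eq) auto
      then have "card {k. k < T \<and> z \<omega> k} = 0 \<or> card {k. k < T \<and> z \<omega> k} = 1" by linarith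
      then have "N \<omega> = 0 \<or> N \<omega> = 1" unfolding Nc by (metis of_nat_0 of_nat_1)
      then show ?thesis by auto
    next
      case True
      then obtain k l where kl: "k < T" "l < T" "k \<noteq> l" "z \<omega> k" "z \<omega> l" by auto
      have "card {k, l} \<le> card {k. k < T \<and> z \<omega> k}" using kl by (intro card_mono) auto
      then have N2: "2 \<le> N \<omega>" using kl(3) unfolding Nc by simp
      show ?thesis
      proof (cases "N \<omega> \<le> M")
        case True
        have "N \<omega> * (N \<omega> - 1) \<le> M * M" using True N2 by (intro mult_mono) auto
        moreover have "0 \<le> N \<omega> * (N \<omega> - 1) * (N \<omega> - 2) / (16 * x)" using N2 x0 by simp
        ultimately show ?thesis using \<open>\<exists>k<T. \<exists>l<T. k \<noteq> l \<and> z \<omega> k \<and> z \<omega> l\<close> by (simp add: power2_eq_square)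
      next
        case False
        then have "1 \<le> (N \<omega> - 2) / (16 * x)" using x0 by (simp add: M_def)
        then have "N \<omega> * (N \<omega> - 1) * 1 \<le> N \<omega> * (N \<omega> - 1) * ((N \<omega> - 2) / (16 * x))"
          using N2 by (intro mult_left_mono) auto
        then show ?thesis by (simp add: add_increasing)
      qed
    qed
  qed
  have S2: "real T * (real T - 1) * (D * (fact (n - 4))\<^sup>2) \<le> (\<Sum>\<omega>\<in>Sym2 n. N \<omega> * (N \<omega> - 1))"
  proof -
    have "D * (fact (n - 4))\<^sup>2 \<le> real (card {\<omega> \<in> Sym2 n. z \<omega> k \<and> z \<omega> l})"
      if "k < T" "l < T" "k \<noteq> l" for k l
    proof -
      have "card {(Q, Q') \<in> A \<times> A. \<not> meets Q Q'} * (fact (n - 4))\<^sup>2 \<le> card {\<omega> \<in> Sym2 n. z \<omega> k \<and> z \<omega> l}"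
        unfolding z_def A by (rule card_quads_2_ge) (use that T in auto)
      then have "real (card {(Q, Q') \<in> A \<times> A. \<not> meets Q Q'} * (fact (n - 4))\<^sup>2) \<le> real (card {\<omega> \<in> Sym2 n. z \<omega> k \<and> z \<omega> l})"
        by (simp only: of_nat_le_iff)
      then show ?thesis by (simp add: D_def)
    qed
    then have "(\<Sum>k\<in>{..<T}. \<Sum>l\<in>{..<T} - {k}. D * (fact (n - 4))\<^sup>2)
        \<le> (\<Sum>k\<in>{..<T}. \<Sum>l\<in>{..<T} - {k}. real (card {\<omega> \<in> Sym2 n. z \<omega> k \<and> z \<omega> l}))"
      by (intro sum_mono) auto
    also have "(\<Sum>k\<in>{..<T}. \<Sum>l\<in>{..<T} - {k}. D * (fact (n - 4))\<^sup>2) = real T * (real T - 1) * (D * (fact (n - 4))\<^sup>2)"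
      using T by (simp add: card_Diff_singleton of_nat_diff)
    finally show ?thesis
      unfolding N_def by (subst sum_pairs_of_bool) auto
  qed
  have S3: "(\<Sum>\<omega>\<in>Sym2 n. N \<omega> * (N \<omega> - 1) * (N \<omega> - 2)) \<le> real T ^ 3 * (a ^ 3 * (fact (n - 6))\<^sup>2)"
  proof -
    have each: "real (card {\<omega> \<in> Sym2 n. z \<omega> k \<and> z \<omega> l \<and> z \<omega> m}) \<le> a ^ 3 * (fact (n - 6))\<^sup>2"
      if "k < T" "l < T" "k \<noteq> l" "m < T" "m \<noteq> k" "m \<noteq> l" for k l m
    proof -
      have "card {\<omega> \<in> Sym2 n. z \<omega> k \<and> z \<omega> l \<and> z \<omega> m} \<le> card A * card A * card A * (fact (n - 6))\<^sup>2"
        unfolding z_def by (rule card_quads_3_le) (use that T finA in auto)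
      then have "real (card {\<omega> \<in> Sym2 n. z \<omega> k \<and> z \<omega> l \<and> z \<omega> m}) \<le> real (card A * card A * card A * (fact (n - 6))\<^sup>2)"
        by (simp only: of_nat_le_iff)
      then show ?thesis by (simp add: a_def power3_eq_cube)
    qed
    define B where "B = a ^ 3 * (fact (n - 6))\<^sup>2"
    have B: "0 \<le> B" using a by (simp add: B_def)
    have "(\<Sum>\<omega>\<in>Sym2 n. N \<omega> * (N \<omega> - 1) * (N \<omega> - 2))
        = (\<Sum>k\<in>{..<T}. \<Sum>l\<in>{..<T} - {k}. \<Sum>m\<in>{..<T} - {k, l}. real (card {\<omega> \<in> Sym2 n. z \<omega> k \<and> z \<omega> l \<and> z \<omega> m}))"
      unfolding N_def by (rule sum_triples_of_bool) auto
    also have "\<dots> \<le> (\<Sum>k\<in>{..<T}. \<Sum>l\<in>{..<T} - {k}. \<Sum>m\<in>{..<T} - {k, l}. B)"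
      unfolding B_def by (intro sum_mono each) auto
    also have "\<dots> \<le> (\<Sum>k\<in>{..<T}. \<Sum>l\<in>{..<T}. \<Sum>m\<in>{..<T}. B)"
      by (intro sum_mono order_trans[OF sum_mono sum_mono2] sum_mono2 sum_nonneg B) auto
    finally show ?thesis by (simp add: B_def power3_eq_cube mult.assoc)
  qed
  have "(\<Sum>\<omega>\<in>Sym2 n. N \<omega> * (N \<omega> - 1)) \<le> (\<Sum>\<omega>\<in>Sym2 n. M\<^sup>2 * of_bool (\<exists>k<T. \<exists>l<T. k \<noteq> l \<and> z \<omega> k \<and> z \<omega> l)
      + N \<omega> * (N \<omega> - 1) * (N \<omega> - 2) / (16 * x))"
    by (rule sum_mono) (rule point)
  also have "\<dots> = M\<^sup>2 * real (card G) + (\<Sum>\<omega>\<in>Sym2 n. N \<omega> * (N \<omega> - 1) * (N \<omega> - 2)) / (16 * x)"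
    by (simp only: sum.distrib sum_distrib_left[symmetric] sum_divide_distrib[symmetric] sum_of_bool_card[OF finite_Sym2] G_def)
  also have "\<dots> \<le> M\<^sup>2 * (4 * \<epsilon> * (fact n)\<^sup>2) + (real T ^ 3 * (a ^ 3 * (fact (n - 6))\<^sup>2)) / (16 * x)"
    using cG S3 x0 by (intro add_mono mult_left_mono divide_right_mono) auto
  finally have main: "real T * (real T - 1) * (D * (fact (n - 4))\<^sup>2)
      \<le> M\<^sup>2 * (4 * \<epsilon> * (fact n)\<^sup>2) + (real T ^ 3 * (a ^ 3 * (fact (n - 6))\<^sup>2)) / (16 * x)"
    using S2 by linarith
  \<comment> \<open>In units of (n!)^2 the second moment is at least x^2 / 4 and the third at most 2
    x^3. The divisor 16 x turns the latter into x^2 / 8, half of the former, so the event of two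
    active pairs must pay for the rest.\<close>
  define \<Phi> where "\<Phi> = (fact n :: real)\<^sup>2"
  have \<Phi>: "\<Phi> > 0" by (simp add: \<Phi>_def)
  have "x\<^sup>2 / 4 * \<Phi> = (real T)\<^sup>2 / 2 * (a\<^sup>2 / 2 * (\<Phi> / real n ^ 8))"
    by (simp add: xa power_divide power_mult_distrib power_mult[symmetric])
  also have "\<dots> \<le> real T * (real T - 1) * (D * (fact (n - 4))\<^sup>2)"
  proof (intro mult_mono D)
    show "(real T)\<^sup>2 / 2 \<le> real T * (real T - 1)"
    proof -
      have "0 \<le> real T * (real T - 2)" using T by simp
      then show ?thesis by (simp add: power2_eq_square algebra_simps)
    qed
    show "\<Phi> / real n ^ 8 \<le> (fact (n - 4))\<^sup>2" unfolding \<Phi>_def by (rule fact_ratio_4_sq[OF n])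
  qed (use a T \<Phi> in \<open>auto simp: D_def\<close>)
  finally have lo: "x\<^sup>2 / 4 * \<Phi> \<le> real T * (real T - 1) * (D * (fact (n - 4))\<^sup>2)" .
  have "(real T ^ 3 * (a ^ 3 * (fact (n - 6))\<^sup>2)) / (16 * x) \<le> (real T ^ 3 * (a ^ 3 * (2 * \<Phi> / real n ^ 12))) / (16 * x)"
    unfolding \<Phi>_def using a x0 by (intro divide_right_mono mult_left_mono fact_ratio_6_sq[OF n]) auto
  also have "real T ^ 3 * (a ^ 3 * (2 * \<Phi> / real n ^ 12)) = 2 * x ^ 3 * \<Phi>"
    by (simp add: xa power_divide power_mult_distrib power_mult[symmetric])
  also have "2 * x ^ 3 * \<Phi> / (16 * x) = x\<^sup>2 / 8 * \<Phi>"
    using x0 by (simp add: power3_eq_cube power2_eq_square)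
  finally have "x\<^sup>2 / 4 * \<Phi> \<le> M\<^sup>2 * (4 * \<epsilon> * \<Phi>) + x\<^sup>2 / 8 * \<Phi>"
    using main lo unfolding \<Phi>_def by linarith
  then have "x\<^sup>2 / 8 * \<Phi> \<le> (4 * \<epsilon> * M\<^sup>2) * \<Phi>" by (simp add: algebra_simps)
  then have "x\<^sup>2 / 8 \<le> 4 * \<epsilon> * M\<^sup>2" using \<Phi> by (simp only: mult_le_cancel_right_pos)
  then show ?thesis by (simp add: M_def)
qed

text \<open>The first row i is avoided by the other quadruple, so they can only meet in the second
  row or in one of the two columns: three positions with two values each, and two free
  coordinates.\<close>

lemma card_meets_row_le:
  assumes "X \<subseteq> {i} \<times> {1..n} \<times> {1..n} \<times> {1..n}" "r \<noteq> i" "r' \<noteq> i"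
  shows "card {Q \<in> X. meets Q (r, r', m, m')} \<le> 6 * n\<^sup>2"
proof -
  define U1 where "U1 = {i} \<times> {r, r'} \<times> {1..n} \<times> {1..n}"
  define U2 where "U2 = {i} \<times> {1..n} \<times> {m, m'} \<times> {1..n}"
  define U3 where "U3 = {i} \<times> {1..n} \<times> {1..n} \<times> {m, m'}"
  have two: "card {a, b} \<le> 2" for a b :: nat by (simp add: card_insert_if)
  have "{Q \<in> X. meets Q (r, r', m, m')} \<subseteq> U1 \<union> U2 \<union> U3"
  proof
    fix Q assume "Q \<in> {Q \<in> X. meets Q (r, r', m, m')}"
    then obtain i' j j' where "Q = (i, i', j, j')" "i' \<in> {1..n}" "j \<in> {1..n}" "j' \<in> {1..n}"
      "meets (i, i', j, j') (r, r', m, m')" using assms(1) by blast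
    then show "Q \<in> U1 \<union> U2 \<union> U3"
      using assms(2,3) by (auto simp: meets_def U1_def U2_def U3_def)
  qed
  then have "card {Q \<in> X. meets Q (r, r', m, m')} \<le> card (U1 \<union> U2 \<union> U3)"
    by (rule card_mono[rotated]) (auto simp: U1_def U2_def U3_def)
  also have "\<dots> \<le> card U1 + card U2 + card U3"
    by (intro order_trans[OF card_Un_le] add_mono card_Un_le order_refl)
  also have "\<dots> \<le> 2 * n\<^sup>2 + 2 * n\<^sup>2 + 2 * n\<^sup>2"
  proof (intro add_mono)
    show "card U1 \<le> 2 * n\<^sup>2" "card U2 \<le> 2 * n\<^sup>2" "card U3 \<le> 2 * n\<^sup>2"
      using two by (simp_all add: U1_def U2_def U3_def card_cartesian_product power2_eq_square)
  qed
  finally show ?thesis by simp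
qed

text \<open>Condition on \<open>\<sigma> 1 = i\<close> and on the pair \<open>0\<close> being active: then, up to a
  small exceptional probability, no further pair is active.\<close>

lemma few_sensitive_off_row:
  assumes n: "250 \<le> n" and b: "real (card (bad n c)) \<le> \<epsilon> * fact n" and \<epsilon>: "0 \<le> \<epsilon>" and i: "i \<in> {1..n}"
    and X: "X = {Q \<in> sensitive_quads n c {1..n}. fst Q = i}" and Y: "Y = sensitive_quads n c ({1..n} - {i})"
    and w: "12 * n\<^sup>2 \<le> card X"
    and x: "x = (real (n div 2) - 1) * card Y / real n ^ 4"
  shows "card X / real n ^ 3 * (x / 4) \<le> 4 * \<epsilon> * (1 + 8 * x)"
proof (cases "Y = {}")
  case True
  then show ?thesis using \<epsilon> by (simp add: x)
next
  case False
  have fin: "finite X" "finite Y" by (simp_all add: X Y)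
  define T where "T = n div 2"
  have T: "2 * T \<le> n" "2 \<le> T" using n by (auto simp: T_def)
  define a where "a = real (card Y)"
  have a: "a > 0" using False fin by (simp add: a_def card_gt_0_iff)
  define t where "t = real T - 1"
  have t: "t > 0" using T by (simp add: t_def)
  have xa: "x = t * a / real n ^ 4" by (simp add: x t_def T_def a_def)
  have x0: "x > 0" using a t n by (simp add: xa)
  define v where "v = real (card X)"
  have v: "v \<ge> 0" by (simp add: v_def)
  define D where "D = real (card {(Q, Q') \<in> X \<times> Y. \<not> meets Q Q'})"
  have sub: "X \<subseteq> sensitive_quads n c {1..n}" "Y \<subseteq> sensitive_quads n c {1..n}" by (auto simp: X Y sensitive_quads_def)
  \<comment> \<open>At most 6 n^2 members of X meet Q', which is at most half of X by the lower
    bound 12 n^2.\<close>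
  have "2 * card {Q \<in> X. meets Q Q'} \<le> card X" if Q': "Q' \<in> Y" for Q'
  proof -
    obtain r r' m m' where q: "Q' = (r, r', m, m')" by (cases Q') auto
    have "card {Q \<in> X. meets Q Q'} \<le> 6 * n\<^sup>2"
      unfolding q by (rule card_meets_row_le[of X i]) (use Q' in \<open>auto simp: q X Y sensitive_quads_def\<close>)
    then show ?thesis using w by linarith
  qed
  then have "card X * card Y \<le> 2 * card {(Q, Q') \<in> X \<times> Y. \<not> meets Q Q'}"
    by (intro card_not_meets fin)
  then have "real (card X * card Y) \<le> real (2 * card {(Q, Q') \<in> X \<times> Y. \<not> meets Q Q'})"
    by (simp only: of_nat_le_iff)
  then have D: "v * a / 2 \<le> D" by (simp add: a_def D_def v_def)
  \<comment> \<open>Block 0 is reserved for X, so only the T - 1 remaining blocks are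
    counted.\<close>
  define I where "I = {1..<T}"
  have I: "finite I" "real (card I) = t" using T by (auto simp: I_def t_def of_nat_diff)
  define z where "z \<omega> k \<longleftrightarrow> quad_at \<omega> k \<in> Y" for \<omega> k
  define S where "S = {\<omega> \<in> Sym2 n. quad_at \<omega> 0 \<in> X}"
  have finS: "finite S" by (simp add: S_def)
  define N where "N \<omega> = (\<Sum>k\<in>I. of_bool (z \<omega> k) :: real)" for \<omega>
  define G where "G = {\<omega> \<in> S. \<exists>k\<in>I. z \<omega> k}"
  define \<Phi> where "\<Phi> = (fact n :: real)\<^sup>2"
  have \<Phi>: "\<Phi> > 0" by (simp add: \<Phi>_def)
  \<comment> \<open>Every matching in G has i as its first row, an event of probability 1/n. This
    factor compensates for X having at most n^3 elements.\<close>
  have cG: "real (card G) \<le> 4 * \<epsilon> * (\<Phi> / n)"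
  proof -
    have "G \<subseteq> {\<omega> \<in> Sym2 n. fst \<omega> 1 = i \<and> (\<exists>k<T. \<exists>l<T. k \<noteq> l \<and> quad_at \<omega> k \<in> sensitive_quads n c {1..n}
            \<and> quad_at \<omega> l \<in> sensitive_quads n c {1..n})}"
    proof
      fix \<omega> assume "\<omega> \<in> G"
      then obtain k where k: "\<omega> \<in> Sym2 n" "quad_at \<omega> 0 \<in> X" "1 \<le> k" "k < T" "quad_at \<omega> k \<in> Y"
        by (auto simp: G_def S_def I_def z_def)
      have "fst \<omega> 1 = i" using k(2) by (simp add: X quad_at_def)
      moreover have "\<exists>k<T. \<exists>l<T. k \<noteq> l \<and> quad_at \<omega> k \<in> sensitive_quads n c {1..n} \<and> quad_at \<omega> l \<in> sensitive_quads n c {1..n}"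
        using k sub by (intro exI[of _ 0] exI[of _ k] conjI) auto
      ultimately show "\<omega> \<in> {\<omega> \<in> Sym2 n. fst \<omega> 1 = i \<and> (\<exists>k<T. \<exists>l<T. k \<noteq> l \<and> quad_at \<omega> k \<in> sensitive_quads n c {1..n}
            \<and> quad_at \<omega> l \<in> sensitive_quads n c {1..n})}" using k(1) by blast
    qed
    then have "card G \<le> card {\<omega> \<in> Sym2 n. fst \<omega> 1 = i \<and> (\<exists>k<T. \<exists>l<T. k \<noteq> l \<and> quad_at \<omega> k \<in> sensitive_quads n c {1..n}
            \<and> quad_at \<omega> l \<in> sensitive_quads n c {1..n})}"
      by (rule card_mono[rotated]) simp
    also have "\<dots> \<le> card {\<sigma> \<in> Sym n. \<sigma> 1 = i} * (4 * card (bad n c))"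
      by (rule card_two_sensitive_le[OF T(1)])
    also have "card {\<sigma> \<in> Sym n. \<sigma> 1 = i} = fact (n - 1)"
    proof -
      have "{j \<in> {1..n}. j = i} = {i}" using i by auto
      then show ?thesis using card_Sym_at[of 1 n "\<lambda>j. j = i"] n by simp
    qed
    finally have "real (card G) \<le> real (fact (n - 1) * (4 * card (bad n c)))" by (simp only: of_nat_le_iff)
    also have "\<dots> \<le> fact (n - 1) * (4 * (\<epsilon> * fact n))" using b by simp
    also have "\<dots> = 4 * \<epsilon> * (\<Phi> / n)"
      using n fact_reduce[of n, where 'a = real] by (simp add: \<Phi>_def power2_eq_square)
    finally show ?thesis .
  qed
  \<comment> \<open>As before with moments one lower: the restriction to block 0 in X uses up one
    quadruple. For N > M the factor (N - 1) / (8 x) exceeds 1.\<close>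
  define M where "M = 1 + 8 * x"
  have point: "N \<omega> \<le> M * of_bool (\<exists>k\<in>I. z \<omega> k) + N \<omega> * (N \<omega> - 1) / (8 * x)" for \<omega>
  proof (cases "\<exists>k\<in>I. z \<omega> k")
    case False
    then have "N \<omega> = 0" unfolding N_def by (intro sum.neutral) auto
    then show ?thesis using False by simp
  next
    case True
    then obtain k where k: "k \<in> I" "z \<omega> k" by auto
    have "of_bool (z \<omega> k) \<le> N \<omega>"
      unfolding N_def using I k by (intro member_le_sum[of k I "\<lambda>k. of_bool (z \<omega> k)"]) auto
    then have N1: "1 \<le> N \<omega>" using k by simp
    show ?thesis
    proof (cases "N \<omega> \<le> M")
      case True
      moreover have "0 \<le> N \<omega> * (N \<omega> - 1) / (8 * x)" using N1 x0 by simp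
      ultimately show ?thesis using \<open>\<exists>k\<in>I. z \<omega> k\<close> by simp
    next
      case False
      then have "1 \<le> (N \<omega> - 1) / (8 * x)" using x0 by (simp add: M_def)
      then have "N \<omega> * 1 \<le> N \<omega> * ((N \<omega> - 1) / (8 * x))"
        using N1 by (intro mult_left_mono) auto
      moreover have "0 \<le> M" using x0 by (simp add: M_def)
      ultimately show ?thesis by (simp add: add_increasing)
    qed
  qed
  have S1: "t * (D * (fact (n - 4))\<^sup>2) \<le> (\<Sum>\<omega>\<in>S. N \<omega>)"
  proof -
    have each: "D * (fact (n - 4))\<^sup>2 \<le> real (card {\<omega> \<in> S. z \<omega> k})" if "k \<in> I" for k
    proof -
      have "card {(Q, Q') \<in> X \<times> Y. \<not> meets Q Q'} * (fact (n - 4))\<^sup>2 \<le> card {\<omega> \<in> Sym2 n. quad_at \<omega> 0 \<in> X \<and> quad_at \<omega> k \<in> Y}"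
        by (rule card_quads_2_ge[OF _ _ _ sub]) (use that T in \<open>auto simp: I_def\<close>)
      then have "real (card {(Q, Q') \<in> X \<times> Y. \<not> meets Q Q'} * (fact (n - 4))\<^sup>2)
          \<le> real (card {\<omega> \<in> Sym2 n. quad_at \<omega> 0 \<in> X \<and> quad_at \<omega> k \<in> Y})"
        by (simp only: of_nat_le_iff)
      then show ?thesis by (simp add: D_def S_def z_def conj_ac)
    qed
    have "(\<Sum>k\<in>I. D * (fact (n - 4))\<^sup>2) \<le> (\<Sum>k\<in>I. real (card {\<omega> \<in> S. z \<omega> k}))"
      by (rule sum_mono) (rule each)
    also have "\<dots> = (\<Sum>k\<in>I. \<Sum>\<omega>\<in>S. of_bool (z \<omega> k))"
      by (simp only: sum_of_bool_card[OF finS])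
    also have "\<dots> = (\<Sum>\<omega>\<in>S. N \<omega>)" unfolding N_def by (rule sum.swap)
    finally show ?thesis by (simp add: I(2))
  qed
  have S2: "(\<Sum>\<omega>\<in>S. N \<omega> * (N \<omega> - 1)) \<le> t\<^sup>2 * (v * a\<^sup>2 * (fact (n - 6))\<^sup>2)"
  proof -
    define B where "B = v * a\<^sup>2 * (fact (n - 6))\<^sup>2"
    have B: "0 \<le> B" using a v by (simp add: B_def)
    have each: "real (card {\<omega> \<in> S. z \<omega> k \<and> z \<omega> l}) \<le> B" if "k \<in> I" "l \<in> I" "k \<noteq> l" for k l
    proof -
      have "card {\<omega> \<in> Sym2 n. quad_at \<omega> 0 \<in> X \<and> quad_at \<omega> k \<in> Y \<and> quad_at \<omega> l \<in> Y} \<le> card X * card Y * card Y * (fact (n - 6))\<^sup>2"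
        by (rule card_quads_3_le) (use that T fin in \<open>auto simp: I_def\<close>)
      then have "real (card {\<omega> \<in> Sym2 n. quad_at \<omega> 0 \<in> X \<and> quad_at \<omega> k \<in> Y \<and> quad_at \<omega> l \<in> Y})
          \<le> real (card X * card Y * card Y * (fact (n - 6))\<^sup>2)"
        by (simp only: of_nat_le_iff)
      then show ?thesis by (simp add: B_def a_def v_def S_def z_def power2_eq_square conj_ac)
    qed
    have "(\<Sum>\<omega>\<in>S. N \<omega> * (N \<omega> - 1)) = (\<Sum>k\<in>I. \<Sum>l\<in>I - {k}. real (card {\<omega> \<in> S. z \<omega> k \<and> z \<omega> l}))"
      unfolding N_def by (rule sum_pairs_of_bool[OF finS I(1)])
    also have "\<dots> \<le> (\<Sum>k\<in>I. \<Sum>l\<in>I - {k}. B)"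
      by (intro sum_mono each) auto
    also have "\<dots> \<le> (\<Sum>k\<in>I. \<Sum>l\<in>I. B)"
      by (intro sum_mono sum_mono2 B I) auto
    finally show ?thesis by (simp add: B_def I(2) power2_eq_square mult.assoc)
  qed
  have "(\<Sum>\<omega>\<in>S. N \<omega>) \<le> (\<Sum>\<omega>\<in>S. M * of_bool (\<exists>k\<in>I. z \<omega> k) + N \<omega> * (N \<omega> - 1) / (8 * x))"
    by (rule sum_mono) (rule point)
  also have "\<dots> = M * real (card G) + (\<Sum>\<omega>\<in>S. N \<omega> * (N \<omega> - 1)) / (8 * x)"
    by (simp only: sum.distrib sum_distrib_left[symmetric] sum_divide_distrib[symmetric] sum_of_bool_card[OF finS] G_def)
  also have "\<dots> \<le> M * (4 * \<epsilon> * (\<Phi> / n)) + (t\<^sup>2 * (v * a\<^sup>2 * (fact (n - 6))\<^sup>2)) / (8 * x)"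
    using cG S2 x0 by (intro add_mono mult_left_mono divide_right_mono) (auto simp: M_def)
  also have "(t\<^sup>2 * (v * a\<^sup>2 * (fact (n - 6))\<^sup>2)) / (8 * x) \<le> (t\<^sup>2 * (v * a\<^sup>2 * (2 * \<Phi> / real n ^ 12))) / (8 * x)"
    unfolding \<Phi>_def using a x0 v by (intro divide_right_mono mult_left_mono fact_ratio_6_sq[OF n]) auto
  also have "(t\<^sup>2 * (v * a\<^sup>2 * (2 * \<Phi> / real n ^ 12))) = 2 * x\<^sup>2 * (v / real n ^ 4) * \<Phi>"
  proof -
    have "real n ^ 12 = (real n ^ 4)\<^sup>2 * real n ^ 4" by (simp add: power_mult[symmetric] power_add[symmetric])
    then show ?thesis by (simp add: xa power_divide power_mult_distrib)
  qed
  also have "2 * x\<^sup>2 * (v / real n ^ 4) * \<Phi> / (8 * x) = x / 4 * (v / real n ^ 4) * \<Phi>"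
    using x0 by (simp add: power2_eq_square)
  finally have up: "t * (D * (fact (n - 4))\<^sup>2) \<le> M * (4 * \<epsilon> * (\<Phi> / n)) + x / 4 * (v / real n ^ 4) * \<Phi>"
    using S1 by linarith
  \<comment> \<open>The first moment is at least x / 2 and the second, divided by 8 x, at most x /
    4, both in units of v / n^4 * (n!)^2; half of the first moment is left for G.\<close>
  have "x / 2 * (v / real n ^ 4) * \<Phi> = t * (v * a / 2 * (\<Phi> / real n ^ 8))"
  proof -
    have "real n ^ 8 = real n ^ 4 * real n ^ 4" by (simp add: power_add[symmetric])
    then show ?thesis unfolding xa by (simp only: times_divide_eq_left times_divide_eq_right mult_ac divide_divide_eq_left)
  qed
  also have "\<dots> \<le> t * (D * (fact (n - 4))\<^sup>2)"
    using t D fact_ratio_4_sq[OF n] \<Phi> by (intro mult_left_mono mult_mono) (auto simp: \<Phi>_def D_def)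
  finally have "x / 2 * (v / real n ^ 4) * \<Phi> \<le> M * (4 * \<epsilon> * (\<Phi> / n)) + x / 4 * (v / real n ^ 4) * \<Phi>"
    using up by linarith
  then have "x / 4 * (v / real n ^ 4) * \<Phi> \<le> (M * (4 * \<epsilon> / n)) * \<Phi>" by (simp add: algebra_simps)
  then have "x / 4 * (v / real n ^ 4) \<le> M * (4 * \<epsilon> / n)" using \<Phi> by (simp only: mult_le_cancel_right_pos)
  then have "x / 4 * (v / real n ^ 4) * n \<le> M * (4 * \<epsilon> / n) * n" by (rule mult_right_mono) simp
  also have "M * (4 * \<epsilon> / n) * n = 4 * \<epsilon> * M" using n by simp
  also have "x / 4 * (v / real n ^ 4) * n = v / real n ^ 3 * (x / 4)"
    using n by (simp add: power3_eq_cube power4_eq_xxxx mult_ac)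
  finally show ?thesis by (simp add: v_def M_def)
qed

section \<open>From lines to dictators\<close>

text \<open>With R consisting of all rows but i, the sum over the remaining rows in
  \<open>close_to_rows_outside\<close> collapses to a function of \<open>\<pi> i\<close>.\<close>

lemma close_to_row:
  assumes i: "i \<in> {1..n}" and n: "2 \<le> n"
  obtains \<alpha> :: "nat \<Rightarrow> real" where
    "card {\<pi> \<in> Sym n. lin n c \<pi> \<noteq> \<alpha> (\<pi> i)} * (n\<^sup>2 * (n - 1)) \<le> card (sensitive_quads n c ({1..n} - {i})) * fact n"
proof -
  have c: "card ({1..n} - {i}) = n - 1" using i by (simp add: card_Diff_singleton)
  then have "card ({1..n} - {i}) \<noteq> 0" using n by simp
  then have ne: "{1..n} - {i} \<noteq> {}" by (metis card.empty)
  have comp: "{1..n} - ({1..n} - {i}) = {i}" using i by auto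
  obtain \<alpha> c0 where "card {\<pi> \<in> Sym n. lin n c \<pi> \<noteq> c0 + (\<Sum>i\<in>{1..n} - ({1..n} - {i}). \<alpha> i (\<pi> i))} * (n\<^sup>2 * card ({1..n} - {i}))
      \<le> card (sensitive_quads n c ({1..n} - {i})) * fact n"
    using close_to_rows_outside[of "{1..n} - {i}" n c] ne by blast
  then show ?thesis
    using that[of "\<lambda>j. c0 + \<alpha> i j"] unfolding comp c by simp
qed

text \<open>A popular row i makes sensitive quadruples avoiding it rare by
  \<open>few_sensitive_off_row\<close>, and \<open>close_to_row\<close> turns their number into a
  distance from functions of \<open>\<pi> i\<close>.\<close>

lemma few_errors_off_row:
  assumes n: "250 \<le> n" and b: "real (card (bad n c)) \<le> \<epsilon> * fact n" and \<epsilon>: "0 \<le> \<epsilon>" "4096 * \<epsilon> \<le> \<delta>"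
    and \<delta>: "192 \<le> \<delta> * n"
    and X: "\<delta> * real n ^ 3 \<le> 16 * real (card {Q \<in> sensitive_quads n c {1..n}. fst Q = i})"
  shows "\<exists>i\<in>{1..n}. \<exists>\<alpha>. real (card {\<pi> \<in> Sym n. lin n c \<pi> \<noteq> \<alpha> (\<pi> i)}) \<le> 1536 * \<epsilon> / \<delta> * fact n"
proof -
  define X where "X = {Q \<in> sensitive_quads n c {1..n}. fst Q = i}"
  define Y where "Y = sensitive_quads n c ({1..n} - {i})"
  have nn: "real n > 0" using n by simp
  have \<delta>0: "\<delta> > 0" using \<delta> nn by (metis not_numeral_le_zero order_less_le_trans zero_less_mult_iff zero_less_numeral of_nat_0_le_iff linorder_not_less)
  have X': "\<delta> * real n ^ 3 \<le> 16 * real (card X)" using X by (simp add: X_def)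
  \<comment> \<open>The constant is 16 * 12: popularity 1/16 and the 12 n^2 required of X.\<close>
  have "192 * (real n)\<^sup>2 \<le> \<delta> * n * (real n)\<^sup>2" using \<delta> by (intro mult_right_mono) auto
  also have "\<dots> = \<delta> * real n ^ 3" by (simp add: power3_eq_cube power2_eq_square)
  finally have "real (12 * n\<^sup>2) \<le> real (card X)" using X' by simp
  then have w: "12 * n\<^sup>2 \<le> card X" by (simp only: of_nat_le_iff)
  moreover have "0 < 12 * n\<^sup>2" using n by simp
  ultimately have "card X \<noteq> 0" by linarith
  then have "X \<noteq> {}" by (metis card.empty)
  then have i: "i \<in> {1..n}" by (auto simp: X_def sensitive_quads_def)
  define x where "x = (real (n div 2) - 1) * card Y / real n ^ 4"
  have t: "2 / 5 * real n \<le> real (n div 2) - 1"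
  proof -
    have "n \<le> 2 * (n div 2) + 1" by presburger
    then have "real n \<le> 2 * real (n div 2) + 1" by linarith
    then show ?thesis using n by linarith
  qed
  have x0: "0 \<le> x" unfolding x_def using t nn by simp
  have "card X / real n ^ 3 * (x / 4) \<le> 4 * \<epsilon> * (1 + 8 * x)"
    by (rule few_sensitive_off_row[OF n b \<epsilon>(1) i X_def Y_def w x_def])
  moreover have "\<delta> / 16 \<le> card X / real n ^ 3" using X' nn by (simp add: field_simps)
  then have "\<delta> / 16 * (x / 4) \<le> card X / real n ^ 3 * (x / 4)" using x0 by (intro mult_right_mono) auto
  ultimately have "\<delta> / 16 * (x / 4) \<le> 4 * \<epsilon> * (1 + 8 * x)" by linarith
  \<comment> \<open>This absorbs the term 32 \<epsilon> x of the right side into half of \<delta> x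
    / 64, since 4096 = 32 * 128. What is left is \<delta> x / 128 <= 4 \<epsilon>.\<close>
  moreover have "4096 * \<epsilon> * x \<le> \<delta> * x" using \<epsilon>(2) x0 by (rule mult_right_mono)
  ultimately have "\<delta> * x \<le> 512 * \<epsilon>" by (simp add: algebra_simps)
  then have xb: "x \<le> 512 * \<epsilon> / \<delta>" using \<delta>0 by (simp add: le_divide_eq mult.commute)
  have "2 / 5 * real n * card Y \<le> x * real n ^ 4"
    using mult_right_mono[OF t, of "card Y"] nn by (simp add: x_def)
  then have "2 / 5 * card Y \<le> x * real n ^ 3" using nn by (simp add: power3_eq_cube power4_eq_xxxx)
  moreover have "real n ^ 3 \<le> 6 / 5 * ((real n)\<^sup>2 * (real n - 1))"
  proof -
    have "0 \<le> (real n)\<^sup>2 * (real n - 6)" using n by simp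
    then show ?thesis by (simp add: power3_eq_cube power2_eq_square algebra_simps)
  qed
  then have "x * real n ^ 3 \<le> x * (6 / 5 * ((real n)\<^sup>2 * (real n - 1)))" using x0 by (rule mult_left_mono)
  \<comment> \<open>The factor is 5/2 * 6/5 = 3; with the 512 above it gives 1536.\<close>
  ultimately have Yb: "card Y \<le> 3 * x * ((real n)\<^sup>2 * (real n - 1))" by (simp add: algebra_simps)
  obtain \<alpha> where \<alpha>: "card {\<pi> \<in> Sym n. lin n c \<pi> \<noteq> \<alpha> (\<pi> i)} * (n\<^sup>2 * (n - 1)) \<le> card Y * fact n"
    using close_to_row[OF i, of c] n unfolding Y_def by auto
  define F where "F = real (card {\<pi> \<in> Sym n. lin n c \<pi> \<noteq> \<alpha> (\<pi> i)})"
  have "real (card {\<pi> \<in> Sym n. lin n c \<pi> \<noteq> \<alpha> (\<pi> i)} * (n\<^sup>2 * (n - 1))) \<le> real (card Y * fact n)"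
    using \<alpha> by (simp only: of_nat_le_iff)
  then have "F * ((real n)\<^sup>2 * (real n - 1)) \<le> real (card Y) * fact n"
    using n by (simp add: F_def of_nat_diff)
  also have "\<dots> \<le> 3 * x * ((real n)\<^sup>2 * (real n - 1)) * fact n" using Yb by (rule mult_right_mono) simp
  finally have "F * ((real n)\<^sup>2 * (real n - 1)) \<le> (3 * x * fact n) * ((real n)\<^sup>2 * (real n - 1))"
    by (simp add: mult_ac)
  moreover have "0 < (real n)\<^sup>2 * (real n - 1)" using n by simp
  ultimately have "F \<le> 3 * x * fact n" by (simp only: mult_le_cancel_right_pos)
  also have "\<dots> \<le> 1536 * \<epsilon> / \<delta> * fact n" using xb by (intro mult_right_mono) auto
  finally show ?thesis using i unfolding F_def by blast
qed

section \<open>Exchanging rows and columns\<close>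

lemma inv_inv_Sym: "\<pi> \<in> Sym n \<Longrightarrow> inv (inv \<pi>) = \<pi>"
  by (simp add: Sym_def permutes_inv_inv)

text \<open>Transposing the array corresponds to inverting the permutation, so statements about
  columns reduce to those about rows.\<close>

lemma lin_transpose:
  assumes "\<pi> \<in> Sym n"
  shows "lin n (\<lambda>a b. c b a) \<pi> = lin n c (inv \<pi>)"
proof -
  have p: "\<pi> permutes {1..n}" using assms by (simp add: Sym_def)
  show ?thesis
    unfolding lin_def
    by (subst sum.permute[OF p, of "\<lambda>i. c i (inv \<pi> i)"]) (simp add: permutes_inverses[OF p])
qed

lemma card_Sym_inv: "card {\<pi> \<in> Sym n. P (inv \<pi>)} = card {\<pi> \<in> Sym n. P \<pi>}"
  by (rule bij_betw_same_card[of inv], rule bij_betw_byWitness[where f' = inv])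
     (auto simp: inv_inv_Sym inv_Sym)

lemma card_bad_transpose: "card (bad n (\<lambda>a b. c b a)) = card (bad n c)"
proof -
  have "bad n (\<lambda>a b. c b a) = {\<pi> \<in> Sym n. lin n c (inv \<pi>) \<notin> {0, 1}}"
    unfolding bad_def by (auto simp: lin_transpose)
  then show ?thesis unfolding bad_def by (simp only: card_Sym_inv[of n "\<lambda>\<pi>. lin n c \<pi> \<notin> {0, 1}"])
qed

lemma card_sensitive_quads_transpose:
  "card {Q \<in> sensitive_quads n (\<lambda>a b. c b a) {1..n}. fst Q = j} = card {Q \<in> sensitive_quads n c {1..n}. fst (snd (snd Q)) = j}"
  by (rule bij_betw_same_card[of "\<lambda>(r, l, j, j'). (j, j', r, l)"],
      rule bij_betw_byWitness[where f' = "\<lambda>(r, l, j, j'). (j, j', r, l)"])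
     (auto simp: sensitive_quads_def sensitive_def algebra_simps)

text \<open>Two ranges. For n < 10 or \<epsilon> < 1 / (64 n^2) a line meets all sensitive
  quadruples and there is no error at all. Otherwise \<delta> >= 2000 * sqrt \<epsilon> forces
  \<delta> n >= 250, and the moment estimates apply: they first produce a popular line and then
  bound the errors off it.\<close>

lemma close_to_line:
  fixes \<epsilon> \<delta> :: real
  assumes n: "1 \<le> n" and b: "real (card (bad n c)) \<le> \<epsilon> * fact n"
    and \<epsilon>: "0 \<le> \<epsilon>" and \<delta>: "0 < \<delta>" "2000 * sqrt \<epsilon> \<le> \<delta>"
    and p1: "\<delta> * fact n \<le> real (card {\<pi> \<in> Sym n. lin n c \<pi> = 1})"
    and p2: "real (card {\<pi> \<in> Sym n. lin n c \<pi> = 1}) \<le> (1 - \<delta>) * fact n"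
  shows "(\<exists>i\<in>{1..n}. \<exists>\<alpha>. real (card {\<pi> \<in> Sym n. lin n c \<pi> \<noteq> \<alpha> (\<pi> i)}) \<le> 1536 * \<epsilon> / \<delta> * fact n) \<or>
         (\<exists>j\<in>{1..n}. \<exists>\<alpha>. real (card {\<pi> \<in> Sym n. lin n (\<lambda>a b. c b a) \<pi> \<noteq> \<alpha> (\<pi> j)}) \<le> 1536 * \<epsilon> / \<delta> * fact n)"
proof -
  have "\<delta> * fact n \<le> (1 - \<delta>) * fact n" using p1 p2 by linarith
  then have \<delta>1: "\<delta> \<le> 1 / 2" by simp
  have "(2000 * sqrt \<epsilon>)\<^sup>2 \<le> \<delta>\<^sup>2" using \<delta> \<epsilon> by (intro power_mono) auto
  then have \<epsilon>\<delta>: "4000000 * \<epsilon> \<le> \<delta>\<^sup>2" using \<epsilon> by (simp add: power_mult_distrib)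
  have "\<delta>\<^sup>2 \<le> \<delta> * (1 / 2)" unfolding power2_eq_square using \<delta> \<delta>1 by (intro mult_left_mono) auto
  then have \<epsilon>small: "4096 * \<epsilon> \<le> \<delta>" "\<epsilon> \<le> 1 / 20000" using \<epsilon>\<delta> \<epsilon> \<delta>1 \<delta>(1) by linarith+
  define A where "A = sensitive_quads n c {1..n}"
  \<comment> \<open>With R all rows nothing is left outside, so f equals a constant c0 up to a
    proportion |A| / n^3.\<close>
  have big: "\<delta> * real n ^ 3 \<le> card A"
  proof -
    obtain \<alpha> c0 where "card {\<pi> \<in> Sym n. lin n c \<pi> \<noteq> c0 + (\<Sum>i\<in>{1..n} - {1..n}. \<alpha> i (\<pi> i))} * (n\<^sup>2 * card {1..n})
      \<le> card (sensitive_quads n c {1..n}) * fact n"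
      using close_to_rows_outside[of "{1..n}" n c] n by auto
    then have c0: "card {\<pi> \<in> Sym n. lin n c \<pi> \<noteq> c0} * n ^ 3 \<le> card A * fact n"
      by (simp add: A_def power3_eq_cube power2_eq_square)
    \<comment> \<open>No constant is closer than \<delta>: for c0 = 1 by \<open>p2\<close>, and
      otherwise because every point with value 1 is an error.\<close>
    have "\<delta> * fact n \<le> real (card {\<pi> \<in> Sym n. lin n c \<pi> \<noteq> c0})"
    proof (cases "c0 = 1")
      case True
      have "card (Sym n) = card ({\<pi> \<in> Sym n. lin n c \<pi> \<noteq> 1} \<union> {\<pi> \<in> Sym n. lin n c \<pi> = 1})"
        by (rule arg_cong[where f = card]) auto
      also have "\<dots> = card {\<pi> \<in> Sym n. lin n c \<pi> \<noteq> 1} + card {\<pi> \<in> Sym n. lin n c \<pi> = 1}"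
        by (rule card_Un_disjoint) auto
      finally have "real (fact n) = real (card {\<pi> \<in> Sym n. lin n c \<pi> \<noteq> 1} + card {\<pi> \<in> Sym n. lin n c \<pi> = 1})"
        by (simp only: card_Sym)
      then show ?thesis using p2 True by (simp add: algebra_simps)
    next
      case False
      then have "card {\<pi> \<in> Sym n. lin n c \<pi> = 1} \<le> card {\<pi> \<in> Sym n. lin n c \<pi> \<noteq> c0}"
        by (intro card_mono) auto
      then show ?thesis using p1 by linarith
    qed
    then have "\<delta> * fact n * real n ^ 3 \<le> card {\<pi> \<in> Sym n. lin n c \<pi> \<noteq> c0} * real n ^ 3"
      by (rule mult_right_mono) simp
    also have "\<dots> = real (card {\<pi> \<in> Sym n. lin n c \<pi> \<noteq> c0} * n ^ 3)" by simp
    also have "\<dots> \<le> real (card A * fact n)" using c0 by (simp only: of_nat_le_iff)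
    finally have "(\<delta> * real n ^ 3) * fact n \<le> real (card A) * fact n" by (simp add: mult_ac)
    then show ?thesis by (simp only: mult_le_cancel_right_pos fact_gt_zero)
  qed
  then have "0 < real (card A)" using \<delta> n by (intro order_less_le_trans[OF _ big]) auto
  then have A0: "A \<noteq> {}" by auto
  then obtain r l j j' where "(r, l, j, j') \<in> A" by (metis ex_in_conv prod_cases4)
  then have "r \<in> {1..n}" "l \<in> {1..n}" "r \<noteq> l" using sensitive_distinct[of c r l j j'] by (auto simp: A_def sensitive_quads_def)
  then have n2: "2 \<le> n" by auto
  show ?thesis
  proof (cases "10 \<le> n \<and> 1 \<le> 64 * (real n)\<^sup>2 * \<epsilon>")
    case False
    have R: "\<exists>\<alpha>. real (card {\<pi> \<in> Sym n. lin n c \<pi> \<noteq> \<alpha> (\<pi> i)}) \<le> 1536 * \<epsilon> / \<delta> * fact n"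
      if h: "i \<in> {1..n}" "sensitive_quads n c ({1..n} - {i}) = {}" for c i
    proof -
      obtain \<alpha> where "card {\<pi> \<in> Sym n. lin n c \<pi> \<noteq> \<alpha> (\<pi> i)} * (n\<^sup>2 * (n - 1)) \<le> card (sensitive_quads n c ({1..n} - {i})) * fact n"
        using close_to_row[OF h(1) n2, of c] .
      then have "card {\<pi> \<in> Sym n. lin n c \<pi> \<noteq> \<alpha> (\<pi> i)} = 0" using h(2) n2 by simp
      then have "real (card {\<pi> \<in> Sym n. lin n c \<pi> \<noteq> \<alpha> (\<pi> i)}) = 0" by (simp only: of_nat_0)
      moreover have "0 \<le> 1536 * \<epsilon> / \<delta> * fact n" using \<epsilon> \<delta> by simp
      ultimately show ?thesis by (intro exI[of _ \<alpha>]) linarith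
    qed
    have "(\<exists>i\<in>{1..n}. sensitive_quads n c ({1..n} - {i}) = {}) \<or>
         (\<exists>j\<in>{1..n}. sensitive_quads n (\<lambda>a b. c b a) ({1..n} - {j}) = {})"
      using False by (intro exact_line[OF n2 b \<epsilon> \<epsilon>small(2)]) auto
    then show ?thesis using R[of _ c] R[of _ "\<lambda>a b. c b a"] by blast
  next
    case True
    \<comment> \<open>Here 62500 = 250^2, and 62500 * 64 = 2000^2.\<close>
    have "62500 \<le> 62500 * (64 * (real n)\<^sup>2 * \<epsilon>)" using True by linarith
    also have "\<dots> \<le> \<delta>\<^sup>2 * (real n)\<^sup>2" using mult_right_mono[OF \<epsilon>\<delta>, of "(real n)\<^sup>2"] by (simp add: mult_ac)
    finally have "250\<^sup>2 \<le> (\<delta> * n)\<^sup>2" by (simp add: power_mult_distrib)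
    then have dn: "250 \<le> \<delta> * n" by (rule power2_le_imp_le) (use \<delta> in simp)
    also have "\<dots> \<le> 1 * real n" using \<delta>1 by (intro mult_right_mono) auto
    finally have n250: "250 \<le> n" by simp
    have dn': "192 \<le> \<delta> * n" using dn by linarith
    define x where "x = real (n div 2) * card A / real n ^ 4"
    have "\<not> ((\<forall>i. 16 * card {Q \<in> A. fst Q = i} \<le> card A) \<and> (\<forall>j. 16 * card {Q \<in> A. fst (snd (snd Q)) = j} \<le> card A))"
    proof
      assume "(\<forall>i. 16 * card {Q \<in> A. fst Q = i} \<le> card A) \<and> (\<forall>j. 16 * card {Q \<in> A. fst (snd (snd Q)) = j} \<le> card A)"
      then have "x\<^sup>2 \<le> 32 * \<epsilon> * (2 + 16 * x)\<^sup>2"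
        by (intro spread_imp_small[OF n250 b A_def A0 _ _ x_def]) auto
      \<comment> \<open>Rounding 32 up to a square lets the root be taken. The resulting bound x <=
        24 * sqrt \<epsilon> contradicts x >= 2/5 \<delta>.\<close>
      also have "\<dots> \<le> 36 * \<epsilon> * (2 + 16 * x)\<^sup>2" using \<epsilon> by (intro mult_right_mono) auto
      also have "\<dots> = (6 * sqrt \<epsilon> * (2 + 16 * x))\<^sup>2" using \<epsilon> by (simp add: power_mult_distrib)
      finally have sq: "x\<^sup>2 \<le> (6 * sqrt \<epsilon> * (2 + 16 * x))\<^sup>2" .
      have x0: "0 \<le> x" by (simp add: x_def)
      have "x \<le> 6 * sqrt \<epsilon> * (2 + 16 * x)"
        using sq by (rule power2_le_imp_le) (use x0 \<epsilon> in simp)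
      moreover have "192 * sqrt \<epsilon> \<le> 1" using \<delta> \<delta>1 by linarith
      then have "192 * sqrt \<epsilon> * x \<le> 1 * x" using x0 by (rule mult_right_mono)
      ultimately have "x \<le> 24 * sqrt \<epsilon>" by (simp add: algebra_simps)
      moreover have "2 / 5 * \<delta> \<le> x"
      proof -
        have "n \<le> 2 * (n div 2) + 1" by presburger
        then have "real n \<le> 2 * real (n div 2) + 1" by linarith
        then have "2 / 5 * real n \<le> real (n div 2)" using n250 by linarith
        then have "2 / 5 * real n * (\<delta> * real n ^ 3) \<le> real (n div 2) * card A"
          using big \<delta> by (intro mult_mono) auto
        then have "(2 / 5 * \<delta>) * real n ^ 4 \<le> real (n div 2) * card A"
          by (simp add: power3_eq_cube power4_eq_xxxx mult_ac)
        then show ?thesis using n2 by (simp add: x_def le_divide_eq)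
      qed
      ultimately show False using \<delta> by linarith
    qed
    then consider i where "card A < 16 * card {Q \<in> A. fst Q = i}"
      | j where "card A < 16 * card {Q \<in> A. fst (snd (snd Q)) = j}" by (meson not_le)
    then show ?thesis
    proof cases
      case (1 i)
      then have "real (card A) < real (16 * card {Q \<in> A. fst Q = i})" by (simp only: of_nat_less_iff)
      then have "\<delta> * real n ^ 3 \<le> 16 * real (card {Q \<in> sensitive_quads n c {1..n}. fst Q = i})"
        using big by (simp add: A_def)
      from few_errors_off_row[OF n250 b \<epsilon> \<epsilon>small(1) dn' this] show ?thesis by (rule disjI1)
    next
      case (2 j)
      then have "real (card A) < real (16 * card {Q \<in> A. fst (snd (snd Q)) = j})" by (simp only: of_nat_less_iff)
      then have "\<delta> * real n ^ 3 \<le> 16 * real (card {Q \<in> sensitive_quads n (\<lambda>a b. c b a) {1..n}. fst Q = j})"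
        using big unfolding A_def card_sensitive_quads_transpose[of n c j] by linarith
      moreover have "real (card (bad n (\<lambda>a b. c b a))) \<le> \<epsilon> * fact n" using b by (simp only: card_bad_transpose[of n c])
      ultimately show ?thesis using few_errors_off_row[OF n250 _ \<epsilon> \<epsilon>small(1) dn'] by (intro disjI2)
    qed
  qed
qed

section \<open>Rounding to a dictator\<close>

lemma dictator_row:
  assumes "i \<in> {1..n}" "J \<subseteq> {1..n}"
  shows "dictator n (\<lambda>\<pi>. of_bool (\<pi> i \<in> J))"
  unfolding dictator_def
proof (intro exI[of _ "{i} \<times> J"] conjI ballI)
  fix \<pi> assume "\<pi> \<in> Sym n"
  have "finite J" using assms(2) finite_subset by blast
  then have "(\<Sum>j\<in>J. perm_entry i j \<pi>) = of_bool (\<pi> i \<in> J)"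
    unfolding perm_entry_def by (subst sum.delta') auto
  moreover have "(\<Sum>(i, j)\<in>{i} \<times> J. perm_entry i j \<pi>) = (\<Sum>j\<in>J. perm_entry i j \<pi>)"
    by (simp add: sum.cartesian_product[symmetric])
  ultimately show "of_bool (\<pi> i \<in> J) = (\<Sum>(i, j)\<in>{i} \<times> J. perm_entry i j \<pi>)" by simp
qed (use assms in auto)

lemma dictator_col:
  assumes "j \<in> {1..n}" "J \<subseteq> {1..n}"
  shows "dictator n (\<lambda>\<pi>. of_bool (inv \<pi> j \<in> J))"
  unfolding dictator_def
proof (intro exI[of _ "J \<times> {j}"] conjI ballI)
  fix \<pi> assume "\<pi> \<in> Sym n"
  then have p: "\<pi> permutes {1..n}" by (simp add: Sym_def)
  have fin: "finite J" using assms(2) finite_subset by blast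
  have "\<pi> r = j \<longleftrightarrow> inv \<pi> j = r" for r using permutes_inv_eq[OF p] by simp
  then have "(\<Sum>r\<in>J. perm_entry r j \<pi>) = (\<Sum>r\<in>J. if inv \<pi> j = r then 1 else 0)"
    unfolding perm_entry_def by simp
  also have "\<dots> = of_bool (inv \<pi> j \<in> J)" using fin by simp
  finally have "(\<Sum>r\<in>J. perm_entry r j \<pi>) = of_bool (inv \<pi> j \<in> J)" .
  moreover have "(\<Sum>(i, j)\<in>J \<times> {j}. perm_entry i j \<pi>) = (\<Sum>r\<in>J. perm_entry r j \<pi>)"
    by (simp add: sum.cartesian_product[symmetric])
  ultimately show "of_bool (inv \<pi> j \<in> J) = (\<Sum>(i, j)\<in>J \<times> {j}. perm_entry i j \<pi>)" by simp
qed (use assms in auto)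

text \<open>Where f is Boolean and agrees with \<open>\<alpha>\<close>, it also agrees with the
  indicator of \<open>\<alpha>\<close> being 1; the other points are errors of
  \<open>\<alpha>\<close> or bad. The map u covers both kinds of line: the value at a row and the
  inverse image of a column.\<close>

lemma card_neq_rounded_le:
  fixes u :: "(nat \<Rightarrow> nat) \<Rightarrow> nat" and \<alpha> :: "nat \<Rightarrow> real"
  assumes "real (card {\<pi> \<in> Sym n. lin n c \<pi> \<noteq> \<alpha> (u \<pi>)}) \<le> \<kappa> * fact n"
    and "real (card (bad n c)) \<le> \<epsilon> * fact n" and "\<And>\<pi>. \<pi> \<in> Sym n \<Longrightarrow> u \<pi> \<in> {1..n}"
  shows "real (card {\<pi> \<in> Sym n. lin n c \<pi> \<noteq> of_bool (u \<pi> \<in> {j \<in> {1..n}. \<alpha> j = 1})}) \<le> (\<kappa> + \<epsilon>) * fact n"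
proof -
  have "{\<pi> \<in> Sym n. lin n c \<pi> \<noteq> of_bool (u \<pi> \<in> {j \<in> {1..n}. \<alpha> j = 1})}
      \<subseteq> {\<pi> \<in> Sym n. lin n c \<pi> \<noteq> \<alpha> (u \<pi>)} \<union> bad n c"
    using assms(3) by (fastforce simp: bad_def)
  then have "card {\<pi> \<in> Sym n. lin n c \<pi> \<noteq> of_bool (u \<pi> \<in> {j \<in> {1..n}. \<alpha> j = 1})}
      \<le> card ({\<pi> \<in> Sym n. lin n c \<pi> \<noteq> \<alpha> (u \<pi>)} \<union> bad n c)"
    by (rule card_mono[rotated]) (simp add: bad_def)
  also have "\<dots> \<le> card {\<pi> \<in> Sym n. lin n c \<pi> \<noteq> \<alpha> (u \<pi>)} + card (bad n c)" by (rule card_Un_le)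
  finally show ?thesis using assms(1,2) by (simp add: distrib_right)
qed

lemma close_to_dictator:
  assumes n: "1 \<le> n" and \<epsilon>: "0 \<le> \<epsilon>" and \<delta>: "0 < \<delta>" "2000 * sqrt \<epsilon> \<le> \<delta>"
    and f: "linear_on_Sym n f" and b: "Sym_prob n (\<lambda>\<pi>. f \<pi> \<notin> {0, 1}) \<le> \<epsilon>"
    and p: "\<delta> \<le> Sym_prob n (\<lambda>\<pi>. f \<pi> = 1)" "Sym_prob n (\<lambda>\<pi>. f \<pi> = 1) \<le> 1 - \<delta>"
  shows "\<exists>g. dictator n g \<and> Sym_prob n (\<lambda>\<pi>. f \<pi> \<noteq> g \<pi>) \<le> 2000 * \<epsilon> / \<delta>"
proof -
  obtain c where c: "\<forall>\<pi>\<in>Sym n. f \<pi> = (\<Sum>i\<in>{1..n}. \<Sum>j\<in>{1..n}. c i j * perm_entry i j \<pi>)"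
    using f by (auto simp: linear_on_Sym_def)
  have fl: "f \<pi> = lin n c \<pi>" if "\<pi> \<in> Sym n" for \<pi>
  proof -
    have "(\<Sum>j\<in>{1..n}. c i j * perm_entry i j \<pi>) = c i (\<pi> i)" if "i \<in> {1..n}" for i
    proof -
      have "(\<Sum>j\<in>{1..n}. c i j * perm_entry i j \<pi>) = (\<Sum>j\<in>{1..n}. if \<pi> i = j then c i j else 0)"
        by (intro sum.cong refl) (simp add: perm_entry_def)
      then show ?thesis using Sym_in[OF \<open>\<pi> \<in> Sym n\<close> that] by (simp only: sum.delta' finite_atLeastAtMost if_True)
    qed
    then show ?thesis using c that by (simp add: lin_def)
  qed
  have pr: "Sym_prob n (\<lambda>\<pi>. P (f \<pi>) \<pi>) = real (card {\<pi> \<in> Sym n. P (lin n c \<pi>) \<pi>}) / fact n" for P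
    unfolding Sym_prob_eq using fl by (metis (mono_tags, lifting) Collect_cong)
  have b': "real (card (bad n c)) \<le> \<epsilon> * fact n"
    using b unfolding pr[of "\<lambda>v _. v \<notin> {0, 1}"] bad_def by (simp add: divide_le_eq)
  have line: "(\<exists>i\<in>{1..n}. \<exists>\<alpha>. real (card {\<pi> \<in> Sym n. lin n c \<pi> \<noteq> \<alpha> (\<pi> i)}) \<le> 1536 * \<epsilon> / \<delta> * fact n) \<or>
         (\<exists>j\<in>{1..n}. \<exists>\<alpha>. real (card {\<pi> \<in> Sym n. lin n (\<lambda>a b. c b a) \<pi> \<noteq> \<alpha> (\<pi> j)}) \<le> 1536 * \<epsilon> / \<delta> * fact n)"
    using p unfolding pr[of "\<lambda>v _. v = 1"]
    by (intro close_to_line[OF n b' \<epsilon> \<delta>]) (simp_all add: divide_le_eq le_divide_eq)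
  have "fact n * \<delta> \<le> fact n * (1 - \<delta>)" using p by (intro mult_left_mono) auto
  then have "\<delta> \<le> 1" by simp
  then have "\<epsilon> \<le> \<epsilon> / \<delta>" using \<delta> \<epsilon> by (simp add: le_divide_eq mult_left_le)
  \<comment> \<open>The rounding costs a further \<epsilon>, at most \<epsilon> / \<delta> because
    \<delta> <= 1.\<close>
  then have K: "1536 * \<epsilon> / \<delta> + \<epsilon> \<le> 2000 * \<epsilon> / \<delta>" using \<epsilon> \<delta> by simp
  have fin: "\<exists>g. dictator n g \<and> Sym_prob n (\<lambda>\<pi>. f \<pi> \<noteq> g \<pi>) \<le> 2000 * \<epsilon> / \<delta>"
    if g: "dictator n g" "real (card {\<pi> \<in> Sym n. lin n c \<pi> \<noteq> g \<pi>}) \<le> (1536 * \<epsilon> / \<delta> + \<epsilon>) * fact n" for g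
  proof -
    have "Sym_prob n (\<lambda>\<pi>. f \<pi> \<noteq> g \<pi>) \<le> 1536 * \<epsilon> / \<delta> + \<epsilon>"
      using g(2) unfolding pr[of "\<lambda>v \<pi>. v \<noteq> g \<pi>"] by (simp add: divide_le_eq)
    then show ?thesis using g(1) K by (intro exI[of _ g]) auto
  qed
  from line show ?thesis
  proof (elim disjE bexE exE)
    fix i \<alpha> assume i: "i \<in> {1..n}" and a: "real (card {\<pi> \<in> Sym n. lin n c \<pi> \<noteq> \<alpha> (\<pi> i)}) \<le> 1536 * \<epsilon> / \<delta> * fact n"
    show ?thesis
      by (rule fin[OF dictator_row[OF i] card_neq_rounded_le[OF a b']]) (use Sym_in i in auto)
  next
    fix j \<alpha> assume j: "j \<in> {1..n}"
      and a: "real (card {\<pi> \<in> Sym n. lin n (\<lambda>a b. c b a) \<pi> \<noteq> \<alpha> (\<pi> j)}) \<le> 1536 * \<epsilon> / \<delta> * fact n"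
    \<comment> \<open>Substituting \<open>inv \<pi>\<close> turns a row of the transposed array into
      a column of the original one.\<close>
    have "{\<pi> \<in> Sym n. lin n (\<lambda>a b. c b a) \<pi> \<noteq> \<alpha> (\<pi> j)} = {\<pi> \<in> Sym n. lin n c (inv \<pi>) \<noteq> \<alpha> (inv (inv \<pi>) j)}"
      by (auto simp: lin_transpose inv_inv_Sym)
    then have a': "real (card {\<pi> \<in> Sym n. lin n c \<pi> \<noteq> \<alpha> (inv \<pi> j)}) \<le> 1536 * \<epsilon> / \<delta> * fact n"
      using a card_Sym_inv[of n "\<lambda>\<pi>. lin n c \<pi> \<noteq> \<alpha> (inv \<pi> j)"] by simp
    show ?thesis
      by (rule fin[OF dictator_col[OF j] card_neq_rounded_le[OF a' b']]) (use Sym_in[OF inv_Sym, of _ n j] j in auto)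
  qed
qed

theorem theorem1p7:
  shows "\<exists>K > (0::real). \<exists>K' > (0::real).
    \<forall>(n::nat) (\<epsilon>::real) (\<delta>::real) (f :: (nat \<Rightarrow> nat) \<Rightarrow> real).
      n \<ge> 1 \<longrightarrow> \<epsilon> \<ge> 0 \<longrightarrow> \<delta> > 0 \<longrightarrow> \<delta> \<ge> K * sqrt \<epsilon> \<longrightarrow>
      linear_on_Sym n f \<longrightarrow>
      Sym_prob n (\<lambda>\<pi>. f \<pi> \<notin> {0, 1}) \<le> \<epsilon> \<longrightarrow>
      \<delta> \<le> Sym_prob n (\<lambda>\<pi>. f \<pi> = 1) \<longrightarrow>
      Sym_prob n (\<lambda>\<pi>. f \<pi> = 1) \<le> 1 - \<delta> \<longrightarrow>
      (\<exists>g. dictator n g \<and> Sym_prob n (\<lambda>\<pi>. f \<pi> \<noteq> g \<pi>) \<le> K' * \<epsilon> / \<delta>)"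
  by (rule exI[of _ 2000], rule conjI, simp, rule exI[of _ 2000], rule conjI, simp)
     (intro allI impI close_to_dictator)

end
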